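(* Let $(X,d)$ be a complete $c$-uniformly perfect metric space ($c>0$), let $S\subset X$ be a Bernstein set, and fix $0<\alpha,\beta<1$. (i) If $\alpha,\beta<c/(1+2c)$, then Schmidt's $(\alpha,\beta,S)$-game and the $(\alpha,\beta,S)$-strong winning game are undetermined. (ii) If $(X,d)$ is a Banach space and $1+\alpha\beta>2\max(\alpha,\beta)$, then Schmidt's $(\alpha,\beta,S)$-game and the $(\alpha,\beta,S)$-strong winning game are undetermined. (iii) If $\beta<(c/5)^2$, then the $(\beta,S)$-absolute winning game is undetermined. (iv) If $(X,d)$ is a Banach space and $\beta<1/3$, then the $(\beta,S)$-absolute winning game is undetermined.
   Context: $S\subset X$ is a Bernstein set if every closed perfect subset of $X$ intersects both $S$ and $X\setminus S$. $(X,d)$ is $c$-uniformly perfect if $B(x,\rho)\setminus B(x,c\rho)\neq\emptyset$ for every $x\in X$ and $0<\rho\le1$, where $B(x,\rho)=\{y\in X: d(x,y)\le\rho\}$. Let $\Omega=X\times\mathbb{R}_{+}$ (formal balls), ordered by $(x_2,\rho_2)\le_s(x_1,\rho_1)$ iff $\rho_2+d(x_1,x_2)\le\rho_1$; $B(\omega)=B(x,\rho)$ for $\omega=(x,\rho)$. Schmidt's $(\alpha,\beta,S)$-game: Bob chooses $\omega_1=(x_1,\rho_1)\in\Omega$; then for $n\ge1$ Alice chooses $\omega_n'=(x_n',\rho_n')\le_s\omega_n$ and Bob chooses $\omega_{n+1}=(x_{n+1},\rho_{n+1})\le_s\omega_n'$, with $\rho_n'=\alpha\rho_n$, $\rho_{n+1}=\beta\rho_n'$;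 $\bigcap_nB(\omega_n)=\{x_\infty\}$ and Alice wins iff $x_\infty\in S$. The $(\alpha,\beta,S)$-strong winning game: same but with $\rho_n'\ge\alpha\rho_n$ and $\rho_{n+1}\ge\beta\rho_n'$; Alice wins iff $\bigcap_nB(\omega_n)\cap S\neq\emptyset$. The $(\beta,S)$-absolute winning game (for $\beta$ small enough that Bob always has a legal move, as is the case under the hypotheses of (iii) and (iv)): Bob chooses $\omega_1\in\Omega$; after Bob's move $\omega_n=(x_n,\rho_n)$, Alice chooses any $\omega_n'=(x_n',\rho_n')\in\Omega$ with $\rho_n'\le\beta\rho_n$; Bob then chooses $\omega_{n+1}=(x_{n+1},\rho_{n+1})\le_s\omega_n$ with $\rho_{n+1}\ge\beta\rho_n$ and $B(\omega_{n+1})\cap B(\omega_n')=\emptyset$. Alice wins iff $\bigcap_nB(\omega_n)\cap S\neq\emptyset$. A strategy for a player assigns to each finite legal history a legal next move for that player; it is winning if every play following it is won by that player. A game is determined if some player has a winning strategy, and undetermined otherwise. *)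

theory Defs
  imports "HOL-Analysis.Analysis"
begin

section \<open>Sets and spaces\<close>

definition uniformly_perfect :: "real \<Rightarrow> 'a::metric_space set \<Rightarrow> bool" where
  "uniformly_perfect c X \<longleftrightarrow>
     (\<forall>x\<in>X. \<forall>\<rho>. 0 < \<rho> \<and> \<rho> \<le> 1 \<longrightarrow> X \<inter> (cball x \<rho> - cball x (c * \<rho>)) \<noteq> {})"

text \<open>The empty set has no isolated points and has to be excluded explicitly.\<close>

definition perfect_subset :: "'a::topological_space set \<Rightarrow> bool" where
  "perfect_subset P \<longleftrightarrow> closed P \<and> P \<noteq> {} \<and> (\<forall>x\<in>P. x islimpt P)"

definition bernstein :: "'a::topological_space set \<Rightarrow> bool" where
  "bernstein S \<longleftrightarrow> (\<forall>P. perfect_subset P \<longrightarrow> P \<inter> S \<noteq> {} \<and> P \<inter> (UNIV - S) \<noteq> {})"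


section \<open>Two-player games of infinite length\<close>

datatype player = Alice | Bob

text \<open>
  A history lists the moves of both players in the order in which they were made. Bob makes the
  first move, so he is to move after a history of even length. In an infinite play \<open>p\<close> the move
  \<open>p (2 * n)\<close> is Bob's \<open>\<omega>\<^sub>n\<^sub>+\<^sub>1\<close>, and \<open>p (2 * n + 1)\<close> is Alice's answer \<open>\<omega>'\<^sub>n\<^sub>+\<^sub>1\<close>.
\<close>

record 'm game =
  legal_move :: "'m list \<Rightarrow> 'm \<Rightarrow> bool"
  alice_wins :: "(nat \<Rightarrow> 'm) \<Rightarrow> bool"

definition to_move :: "'m list \<Rightarrow> player" where
  "to_move h = (if even (length h) then Bob else Alice)"

definition prefix_of :: "(nat \<Rightarrow> 'm) \<Rightarrow> nat \<Rightarrow> 'm list" where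
  "prefix_of p n = map p [0..<n]"

definition legal_history :: "'m game \<Rightarrow> 'm list \<Rightarrow> bool" where
  "legal_history G h \<longleftrightarrow> (\<forall>k<length h. legal_move G (take k h) (h ! k))"

definition legal_play :: "'m game \<Rightarrow> (nat \<Rightarrow> 'm) \<Rightarrow> bool" where
  "legal_play G p \<longleftrightarrow> (\<forall>n. legal_history G (prefix_of p n))"

definition won_by :: "'m game \<Rightarrow> player \<Rightarrow> (nat \<Rightarrow> 'm) \<Rightarrow> bool" where
  "won_by G P p \<longleftrightarrow> (if P = Alice then alice_wins G p else \<not> alice_wins G p)"

definition can_move :: "'m game \<Rightarrow> 'm list \<Rightarrow> bool" where
  "can_move G h \<longleftrightarrow> (\<exists>m. legal_move G h m)"

text \<open>
  The values of a strategy at illegal histories, at histories where the other player is to move,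
  and at histories without any legal continuation are irrelevant.
\<close>

definition strategy :: "'m game \<Rightarrow> player \<Rightarrow> ('m list \<Rightarrow> 'm) \<Rightarrow> bool" where
  "strategy G P \<sigma> \<longleftrightarrow>
     (\<forall>h. legal_history G h \<and> to_move h = P \<and> can_move G h \<longrightarrow> legal_move G h (\<sigma> h))"

definition follows :: "player \<Rightarrow> ('m list \<Rightarrow> 'm) \<Rightarrow> 'm list \<Rightarrow> bool" where
  "follows P \<sigma> h \<longleftrightarrow> (\<forall>k<length h. to_move (take k h) = P \<longrightarrow> h ! k = \<sigma> (take k h))"

text \<open>
  A player who is to move and has no legal move loses; hence a winning strategy never leads its
  owner into such a position. Only Bob in the absolute winning game can ever be stuck. For \<open>\<beta>\<close> small
  relative to the constant of uniform perfectness this needs a radius above 1: in a bounded space,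
  for instance, Alice may delete the whole space if Bob's ball is large enough.
\<close>

definition winning_strategy :: "'m game \<Rightarrow> player \<Rightarrow> ('m list \<Rightarrow> 'm) \<Rightarrow> bool" where
  "winning_strategy G P \<sigma> \<longleftrightarrow>
     strategy G P \<sigma> \<and>
     (\<forall>h. legal_history G h \<and> follows P \<sigma> h \<and> to_move h = P \<longrightarrow> can_move G h) \<and>
     (\<forall>p. legal_play G p \<and> (\<forall>n. follows P \<sigma> (prefix_of p n)) \<longrightarrow> won_by G P p)"

definition determined :: "'m game \<Rightarrow> bool" where
  "determined G \<longleftrightarrow> (\<exists>P \<sigma>. winning_strategy G P \<sigma>)"

abbreviation undetermined :: "'m game \<Rightarrow> bool" where
  "undetermined G \<equiv> \<not> determined G"

text \<open>
  If nobody can get stuck, \<open>winning_strategy\<close> is the plain notion: a legal move at every legal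
  history, and a win in every infinite play. In any game the plain notion implies it, so that
  undetermined games are also undetermined in the plain sense.
\<close>

lemma winning_strategyI_plain:
  assumes "\<And>h. legal_history G h \<Longrightarrow> to_move h = P \<Longrightarrow> legal_move G h (\<sigma> h)"
    and "\<And>p. legal_play G p \<Longrightarrow> (\<And>n. follows P \<sigma> (prefix_of p n)) \<Longrightarrow> won_by G P p"
  shows "winning_strategy G P \<sigma>"
  using assms unfolding winning_strategy_def strategy_def can_move_def by blast

lemma winning_strategy_iff_plain:
  assumes "\<And>h. legal_history G h \<Longrightarrow> to_move h = P \<Longrightarrow> can_move G h"
  shows "winning_strategy G P \<sigma> \<longleftrightarrow>
     (\<forall>h. legal_history G h \<and> to_move h = P \<longrightarrow> legal_move G h (\<sigma> h)) \<and>
     (\<forall>p. legal_play G p \<and> (\<forall>n. follows P \<sigma> (prefix_of p n)) \<longrightarrow> won_by G P p)"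
  using assms unfolding winning_strategy_def strategy_def by blast


section \<open>Formal balls and the three games\<close>

type_synonym 'a fball = "'a \<times> real"

text \<open>Radii are strictly positive.\<close>

definition formal_balls :: "'a fball set" where
  "formal_balls = UNIV \<times> {0<..}"

definition fball_le :: "'a::metric_space fball \<Rightarrow> 'a fball \<Rightarrow> bool" where
  "fball_le \<omega>2 \<omega>1 \<longleftrightarrow> snd \<omega>2 + dist (fst \<omega>1) (fst \<omega>2) \<le> snd \<omega>1"

definition ball_of :: "'a::metric_space fball \<Rightarrow> 'a set" where
  "ball_of \<omega> = cball (fst \<omega>) (snd \<omega>)"

definition outcome :: "(nat \<Rightarrow> 'a::metric_space fball) \<Rightarrow> 'a set" where
  "outcome p = (\<Inter>n. ball_of (p (2 * n)))"

definition schmidt_game :: "real \<Rightarrow> real \<Rightarrow> 'a::metric_space set \<Rightarrow> 'a fball game" where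
  "schmidt_game \<alpha> \<beta> S =
     \<lparr>legal_move = (\<lambda>h \<omega>. \<omega> \<in> formal_balls \<and>
        (h \<noteq> [] \<longrightarrow> fball_le \<omega> (last h) \<and>
           snd \<omega> = (if to_move h = Alice then \<alpha> else \<beta>) * snd (last h))),
      alice_wins = (\<lambda>p. \<exists>x. outcome p = {x} \<and> x \<in> S)\<rparr>"

definition strong_game :: "real \<Rightarrow> real \<Rightarrow> 'a::metric_space set \<Rightarrow> 'a fball game" where
  "strong_game \<alpha> \<beta> S =
     \<lparr>legal_move = (\<lambda>h \<omega>. \<omega> \<in> formal_balls \<and>
        (h \<noteq> [] \<longrightarrow> fball_le \<omega> (last h) \<and>
           snd \<omega> \<ge> (if to_move h = Alice then \<alpha> else \<beta>) * snd (last h))),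
      alice_wins = (\<lambda>p. outcome p \<inter> S \<noteq> {})\<rparr>"

text \<open>
  When Bob is to move after a nonempty history, \<open>last h\<close> is the ball just deleted by Alice and
  \<open>last (butlast h)\<close> is Bob's own previous ball.
\<close>

definition absolute_game :: "real \<Rightarrow> 'a::metric_space set \<Rightarrow> 'a fball game" where
  "absolute_game \<beta> S =
     \<lparr>legal_move = (\<lambda>h \<omega>. \<omega> \<in> formal_balls \<and>
        (h \<noteq> [] \<longrightarrow>
          (if to_move h = Alice then snd \<omega> \<le> \<beta> * snd (last h)
           else fball_le \<omega> (last (butlast h)) \<and>
                snd \<omega> \<ge> \<beta> * snd (last (butlast h)) \<and>
                ball_of \<omega> \<inter> ball_of (last h) = {}))),
      alice_wins = (\<lambda>p. outcome p \<inter> S \<noteq> {})\<rparr>"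

end

theory Submission
  imports Defs
begin

text \<open>
  Suppose that a player has a winning strategy. If the opponent can, from every position, steer
  the play away from any prescribed point, then every play following the strategy can be split
  into two with disjoint balls. Iterating this yields a Cantor scheme, and its outcomes form a
  perfect set that is contained in \<open>S\<close> or disjoint from \<open>S\<close>, contrary to the Bernstein property.

  It remains to evade a point \<open>z\<close>. In (i) one move suffices, to a centre near \<open>z\<close> but not too near.
  In (ii) the opponent keeps moving straight away from \<open>z\<close>. In the absolute game Alice deletes a
  ball around \<open>z\<close>. Bob has three well separated candidates in (iii); in (iv) the relative
  distance of \<open>z\<close> from Bob's centre evolves under a family of maps expanding by more than 3, and
  no set of relative distances in \<open>[0, 1]\<close> can be invariant under all of them.
\<close>

section \<open>Cantor schemes\<close>

text \<open>Splitting aims at the outcome of the play itself: if a play following the strategy ends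
  in \<open>{z}\<close>, it is repeated up to a late position, from which the opponent dodges
  \<open>z\<close>. Both plays share a long prefix but have different outcomes, so their balls are
  eventually disjoint. The position must be late because uniform perfectness controls only radii up
  to 1. The obstacle is that the rules of the strong and the absolute game do not make the radii
  tend to 0, so an outcome need not be a single point. In the ratio games, and for Bob opposing
  Alice in the absolute game, the contracting moves of the opponent suffice. Alice opposing Bob in
  the absolute game has no such moves; there the contraction follows from the strategy being
  winning.\<close>

lemma perfect_range_cantor_scheme:
  fixes f :: "(nat \<Rightarrow> bool) \<Rightarrow> 'a::metric_space" and B :: "(nat \<Rightarrow> bool) \<Rightarrow> nat \<Rightarrow> 'a set"
  assumes cong: "\<And>a b n. (\<forall>i<n. a i = b i) \<Longrightarrow> B a n = B b n"
    and closed_B: "\<And>a n. closed (B a n)"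
    and mem: "\<And>a n. f a \<in> B a n"
    and small: "\<And>a e. e > 0 \<Longrightarrow> \<exists>n. \<forall>x\<in>B a n. dist x (f a) < e"
    and disj: "\<And>a b n. (\<forall>i<n. a i = b i) \<Longrightarrow> a n \<noteq> b n \<Longrightarrow> B a (Suc n) \<inter> B b (Suc n) = {}"
  shows "perfect_subset (range f)"
proof -
  have "x \<in> range f" if x: "x \<in> closure (range f)" for x
  proof -
    \<comment> \<open>A Koenig argument replaces compactness of the sequence space: a point in the
      closure of \<open>C a n\<close> lies in the closure of one of its two halves, and the chosen
      halves spell out a sequence.\<close>
    define C where "C = (\<lambda>a n. f ` {b. \<forall>i<n. b i = a i})"
    have C_split: "C a n \<subseteq> C (a(n := True)) (Suc n) \<union> C (a(n := False)) (Suc n)" for a n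
    proof
      fix y assume "y \<in> C a n"
      then obtain b where b: "\<forall>i<n. b i = a i" "y = f b" by (auto simp: C_def)
      have "b \<in> {b'. \<forall>i<Suc n. b' i = (a(n := b n)) i}" using b(1) by (simp add: less_Suc_eq)
      then have "y \<in> C (a(n := b n)) (Suc n)" unfolding C_def b(2) by (rule imageI)
      then show "y \<in> C (a(n := True)) (Suc n) \<union> C (a(n := False)) (Suc n)"
        by (cases "b n") auto
    qed
    have "\<exists>g. \<forall>n. x \<in> closure (C (g n) n) \<and> (\<forall>i<n. g (Suc n) i = g n i)"
    proof (rule dependent_nat_choice)
      show "\<exists>a. x \<in> closure (C a 0)" using x by (simp add: C_def)
    next
      fix a n assume "x \<in> closure (C a n)"
      then have "x \<in> closure (C (a(n := True)) (Suc n) \<union> C (a(n := False)) (Suc n))"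
        using closure_mono[OF C_split] by blast
      then obtain v where "x \<in> closure (C (a(n := v)) (Suc n))" by auto
      then show "\<exists>b. x \<in> closure (C b (Suc n)) \<and> (\<forall>i<n. b i = a i)"
        by (intro exI[of _ "a(n := v)"]) auto
    qed
    then obtain g where g: "\<And>n. x \<in> closure (C (g n) n)" "\<And>n i. i < n \<Longrightarrow> g (Suc n) i = g n i"
      by blast
    \<comment> \<open>Bit \<open>i\<close> of the approximants \<open>g n\<close> is final from
      \<open>n = Suc i\<close> on.\<close>
    define a where "a = (\<lambda>i. g (Suc i) i)"
    have ga: "g n i = a i" if "i < n" for n i
      using that
    proof (induction n)
      case (Suc n)
      show ?case
      proof (cases "i = n")
        case True
        then show ?thesis by (simp add: a_def)
      next
        case False
        then have "i < n" using Suc.prems by simp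
        then show ?thesis using g(2) Suc.IH by simp
      qed
    qed simp
    have "x \<in> B a n" for n
    proof -
      have "C (g n) n \<subseteq> B a n"
      proof
        fix y assume "y \<in> C (g n) n"
        then obtain b where b: "\<forall>i<n. b i = g n i" "y = f b" by (auto simp: C_def)
        then have "B b n = B a n" by (intro cong) (simp add: ga)
        then show "y \<in> B a n" using mem[of b n] b(2) by simp
      qed
      then show ?thesis using g(1) closed_B closure_minimal by blast
    qed
    then have "dist x (f a) < e" if "e > 0" for e
      using small[OF that] by blast
    then have "x = f a" by (metis dist_nz less_irrefl)
    then show ?thesis by blast
  qed
  then have "closed (range f)"
    by (metis closure_subset closure_closed subset_antisym subsetI closed_closure)
  moreover have "f a islimpt range f" for a
    unfolding islimpt_approachable
  proof (intro allI impI)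
    fix e :: real assume "e > 0"
    then obtain n where n: "\<forall>x\<in>B a n. dist x (f a) < e" using small by blast
    \<comment> \<open>Flipping a late bit keeps the point in the same small ball but moves it into a
      disjoint ball one level deeper.\<close>
    define b where "b = a(n := \<not> a n)"
    have "B b n = B a n" by (rule cong) (simp add: b_def)
    then have "dist (f b) (f a) < e" using n mem[of b n] by simp
    moreover have "B a (Suc n) \<inter> B b (Suc n) = {}" by (rule disj) (auto simp: b_def)
    then have "f b \<noteq> f a" using mem[of a "Suc n"] mem[of b "Suc n"] by auto
    ultimately show "\<exists>x'\<in>range f. x' \<noteq> f a \<and> dist x' (f a) < e" by blast
  qed
  ultimately show ?thesis by (auto simp: perfect_subset_def)
qed


section \<open>Histories and plays\<close>

lemma length_prefix_of [simp]: "length (prefix_of p n) = n"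
  by (simp add: prefix_of_def)

lemma prefix_of_Suc: "prefix_of p (Suc n) = prefix_of p n @ [p n]"
  by (simp add: prefix_of_def)

lemma prefix_of_0 [simp]: "prefix_of p 0 = []"
  by (simp add: prefix_of_def)

lemma prefix_of_eq_iff: "prefix_of p n = prefix_of q n \<longleftrightarrow> (\<forall>i<n. p i = q i)"
  by (auto simp: prefix_of_def)

lemma take_prefix_of: "k \<le> n \<Longrightarrow> take k (prefix_of p n) = prefix_of p k"
  by (simp add: prefix_of_def take_map)

lemma legal_history_Nil [simp]: "legal_history G []"
  by (simp add: legal_history_def)

lemma legal_history_snoc:
  "legal_history G (h @ [m]) \<longleftrightarrow> legal_history G h \<and> legal_move G h m"
  by (auto simp: legal_history_def nth_append less_Suc_eq)

lemma legal_history_take: "legal_history G h \<Longrightarrow> legal_history G (take k h)"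
  by (auto simp: legal_history_def min_def)

lemma legal_play_iff: "legal_play G p \<longleftrightarrow> (\<forall>n. legal_move G (prefix_of p n) (p n))"
proof
  assume "legal_play G p"
  then show "\<forall>n. legal_move G (prefix_of p n) (p n)"
    by (metis legal_history_snoc legal_play_def prefix_of_Suc)
next
  assume *: "\<forall>n. legal_move G (prefix_of p n) (p n)"
  have "legal_history G (prefix_of p n)" for n
    by (induction n) (auto simp: prefix_of_Suc legal_history_snoc *)
  then show "legal_play G p" by (simp add: legal_play_def)
qed

lemma to_move_snoc: "to_move (h @ [m]) = (if to_move h = Alice then Bob else Alice)"
  by (simp add: to_move_def)

text \<open>\<open>Q\<close> is an invariant that one well-chosen move can always preserve. Besides
  legality it can carry the plan of the player who is extending the history.\<close>

lemma extend_to_legal_play: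
  assumes "Q h" and legal: "\<And>h. Q h \<Longrightarrow> legal_history G h"
    and step: "\<And>h. Q h \<Longrightarrow> \<exists>m. Q (h @ [m])"
  obtains p where "legal_play G p" "prefix_of p (length h) = h"
    "\<And>n. length h \<le> n \<Longrightarrow> Q (prefix_of p n)"
proof -
  define nxt where "nxt = (\<lambda>h. h @ [SOME m. Q (h @ [m])])"
  define g where "g = (\<lambda>n. (nxt ^^ n) h)"
  \<comment> \<open>\<open>g n\<close> has length \<open>length h + n\<close>, so move
    \<open>k\<close> is the last entry of the iterate with index
    \<open>Suc k - length h\<close>.\<close>
  define p where "p = (\<lambda>k. if k < length h then h ! k else last (g (Suc k - length h)))"
  have Qg: "Q (g n)" for n
  proof (induction n)
    case (Suc n)
    then show ?case using someI_ex[OF step[OF Suc]] by (simp add: g_def nxt_def)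
  qed (simp add: g_def \<open>Q h\<close>)
  have pg: "prefix_of p (length h + n) = g n" for n
  proof (induction n)
    case 0
    show ?case by (auto simp: g_def p_def prefix_of_def intro: nth_equalityI)
  next
    case (Suc n)
    have "p (length h + n) = last (g (Suc n))" by (simp add: p_def)
    then show ?case using Suc by (simp add: prefix_of_Suc g_def nxt_def)
  qed
  have Qp: "Q (prefix_of p n)" if "length h \<le> n" for n
    using pg[of "n - length h"] Qg[of "n - length h"] that by simp
  have "legal_history G (prefix_of p n)" for n
  proof -
    have "legal_history G (prefix_of p (n + length h))" using Qp legal by simp
    then have "legal_history G (take n (prefix_of p (n + length h)))" by (rule legal_history_take)
    then show ?thesis by (simp add: take_prefix_of)
  qed
  moreover have "prefix_of p (length h) = h" using pg[of 0] by (simp add: g_def)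
  ultimately show ?thesis using that[of p] Qp by (simp add: legal_play_def)
qed


section \<open>Nested formal balls\<close>

lemma fball_le_trans: "fball_le u v \<Longrightarrow> fball_le v w \<Longrightarrow> fball_le u w"
  using dist_triangle[of "fst w" "fst u" "fst v"] by (simp add: fball_le_def)

lemma fball_le_snd: "fball_le u v \<Longrightarrow> snd u \<le> snd v"
  using zero_le_dist[of "fst v" "fst u"] unfolding fball_le_def by linarith

lemma fball_le_ball_of: "fball_le u v \<Longrightarrow> ball_of u \<subseteq> ball_of v"
proof
  fix x assume "fball_le u v" "x \<in> ball_of u"
  then show "x \<in> ball_of v"
    using dist_triangle[of "fst v" x "fst u"] by (simp add: fball_le_def ball_of_def)
qed

lemma fball_le_chain:
  assumes "\<And>n. fball_le (w (Suc n)) (w n)" "m \<le> n"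
  shows "fball_le (w n) (w m)"
  using assms(2)
proof (induction rule: dec_induct)
  case base show ?case by (simp add: fball_le_def)
next
  case (step k) then show ?case using assms(1) fball_le_trans by blast
qed

text \<open>Only Bob's balls, at the even indices, are asked to be nested: in the absolute game
  Alice's balls are the deleted ones.\<close>

definition shrinking :: "(nat \<Rightarrow> 'a::metric_space fball) \<Rightarrow> bool" where
  "shrinking p \<longleftrightarrow> (\<forall>n. fball_le (p (2 * Suc n)) (p (2 * n))) \<and> (\<lambda>n. snd (p (2 * n))) \<longlonglongrightarrow> 0"

text \<open>The order bounds the distance of two centres by the difference of their radii, and these
  converge, so the centres form a Cauchy sequence. A positive limit radius \<open>r\<close> is
  allowed for the sake of the absolute game.\<close>

lemma nested_fballs:
  fixes w :: "nat \<Rightarrow> 'a::complete_space fball"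
  assumes le: "\<And>n. fball_le (w (Suc n)) (w n)" and pos: "\<And>n. 0 \<le> snd (w n)"
  obtains x r where "(\<lambda>n. snd (w n)) \<longlonglongrightarrow> r" "\<And>n. cball x r \<subseteq> ball_of (w n)" "0 \<le> r"
proof -
  have "decseq (\<lambda>n. snd (w n))"
    using le fball_le_snd by (intro decseq_SucI) blast
  then obtain r where r: "(\<lambda>n. snd (w n)) \<longlonglongrightarrow> r" "\<And>n. r \<le> snd (w n)"
    using decseq_convergent[of "\<lambda>n. snd (w n)" 0] pos by blast
  have le': "fball_le (w n) (w m)" if "m \<le> n" for m n
    using fball_le_chain[of w, OF le that] .
  have bound: "dist (fst (w m)) (fst (w n)) \<le> snd (w m) - snd (w n)" if "m \<le> n" for m n
    using le'[OF that] by (simp add: fball_le_def)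
  have "Cauchy (\<lambda>n. fst (w n))"
    unfolding Cauchy_altdef
  proof (intro allI impI)
    fix e :: real assume "e > 0"
    then have "\<forall>\<^sub>F n in sequentially. snd (w n) < r + e"
      using order_tendstoD(2)[OF r(1)] by simp
    then obtain M where M: "snd (w n) < r + e" if "n \<ge> M" for n
      by (auto simp: eventually_sequentially)
    show "\<exists>M. \<forall>m\<ge>M. \<forall>n>m. dist (fst (w m)) (fst (w n)) < e"
    proof (intro exI[of _ M] allI impI)
      fix m n assume "m \<ge> M" "n > m"
      then show "dist (fst (w m)) (fst (w n)) < e"
        using M[of m] r(2)[of n] bound[of m n] by simp
    qed
  qed
  then obtain x where x: "(\<lambda>n. fst (w n)) \<longlonglongrightarrow> x"
    using Cauchy_convergent convergent_def by blast
  have "cball x r \<subseteq> ball_of (w m)" for m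
  proof
    fix y assume y: "y \<in> cball x r"
    have "(\<lambda>n. dist (fst (w m)) (fst (w n))) \<longlonglongrightarrow> dist (fst (w m)) x"
      by (intro tendsto_intros x)
    moreover have "(\<lambda>n. snd (w m) - snd (w n)) \<longlonglongrightarrow> snd (w m) - r"
      by (intro tendsto_intros r)
    ultimately have "dist (fst (w m)) x \<le> snd (w m) - r"
      by (rule LIMSEQ_le) (use bound in blast)
    then show "y \<in> ball_of (w m)"
      using y dist_triangle[of "fst (w m)" y x] by (simp add: ball_of_def)
  qed
  moreover have "0 \<le> r" using r(1) pos LIMSEQ_le_const by blast
  ultimately show ?thesis using that[of r x] r(1) by blast
qed

lemma shrinking_outcome:
  fixes p :: "nat \<Rightarrow> 'a::complete_space fball"
  assumes "shrinking p"
  obtains x where "outcome p = {x}"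
proof -
  have le: "fball_le (p (2 * Suc n)) (p (2 * n))" for n
    using assms by (simp add: shrinking_def)
  have lim: "(\<lambda>n. snd (p (2 * n))) \<longlonglongrightarrow> 0" using assms by (simp add: shrinking_def)
  have "decseq (\<lambda>n. snd (p (2 * n)))"
    using le fball_le_snd by (intro decseq_SucI) blast
  then have "0 \<le> snd (p (2 * n))" for n using decseq_ge lim by blast
  then obtain x r where x: "(\<lambda>n. snd (p (2 * n))) \<longlonglongrightarrow> r" "\<And>n. cball x r \<subseteq> ball_of (p (2 * n))" "0 \<le> r"
    using nested_fballs[of "\<lambda>n. p (2 * n)"] le by metis
  have "x \<in> cball x r" using x(3) by simp
  then have "x \<in> outcome p" using x(2) unfolding outcome_def by blast
  moreover have "y = x" if "y \<in> outcome p" for y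
  proof -
    have *: "dist y x \<le> 2 * snd (p (2 * n))" for n
    proof -
      have "x \<in> ball_of (p (2 * n))" "y \<in> ball_of (p (2 * n))"
        using that \<open>x \<in> outcome p\<close> by (auto simp: outcome_def)
      then show ?thesis
        using dist_triangle3[of y x "fst (p (2 * n))"] by (simp add: ball_of_def)
    qed
    have "(\<lambda>n. 2 * snd (p (2 * n))) \<longlonglongrightarrow> 2 * 0" by (intro tendsto_intros lim)
    then have "dist y x \<le> 0" using * LIMSEQ_le_const by fastforce
    then show ?thesis by simp
  qed
  ultimately have "outcome p = {x}" by blast
  then show ?thesis using that by blast
qed

lemma shrinking_separate:
  fixes p q :: "nat \<Rightarrow> 'a::complete_space fball"
  assumes "shrinking p" "shrinking q" "outcome p \<noteq> outcome q"
  obtains m where "n < m" "ball_of (p (2 * m)) \<inter> ball_of (q (2 * m)) = {}"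
proof -
  obtain x y where xy: "outcome p = {x}" "outcome q = {y}"
    using assms shrinking_outcome by metis
  \<comment> \<open>A common point of both balls would lie within two radii of each outcome; four
    radii below a quarter of the distance cannot bridge it.\<close>
  then have d: "dist x y / 4 > 0" using assms(3) by auto
  have "\<forall>\<^sub>F m in sequentially. snd (p (2 * m)) < dist x y / 4"
    "\<forall>\<^sub>F m in sequentially. snd (q (2 * m)) < dist x y / 4"
    using order_tendstoD(2)[OF _ d] assms(1,2) by (auto simp: shrinking_def)
  then have "\<forall>\<^sub>F m in sequentially. snd (p (2 * m)) < dist x y / 4 \<and> snd (q (2 * m)) < dist x y / 4 \<and> n < m"
    using eventually_gt_at_top[of n] by eventually_elim simp
  then obtain m where m: "snd (p (2 * m)) < dist x y / 4" "snd (q (2 * m)) < dist x y / 4" "n < m"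
    by (metis (mono_tags, lifting) eventually_happens' sequentially_bot)
  have mem: "x \<in> ball_of (p (2 * m))" "y \<in> ball_of (q (2 * m))"
    using xy unfolding outcome_def by blast+
  have False if "w \<in> ball_of (p (2 * m))" "w \<in> ball_of (q (2 * m))" for w
    using that mem m dist_triangle[of x y w] dist_triangle3[of x w "fst (p (2 * m))"]
      dist_triangle3[of w y "fst (q (2 * m))"]
    by (simp add: ball_of_def)
  then show ?thesis using that m by blast
qed


section \<open>Perfect sets of outcomes\<close>

lemma perfect_set_of_outcomes:
  fixes G :: "'a::complete_space fball game"
  assumes p0: "legal_play G p0"
    and shr: "\<And>p. legal_play G p \<Longrightarrow> shrinking p"
    and split: "\<And>p n. legal_play G p \<Longrightarrow>
      \<exists>q. legal_play G q \<and> prefix_of q n = prefix_of p n \<and> outcome q \<noteq> outcome p"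
  obtains K where "perfect_subset K" "\<And>x. x \<in> K \<Longrightarrow> \<exists>p. legal_play G p \<and> outcome p = {x}"
proof -
  have "\<exists>q m. legal_play G q \<and> n < m \<and> (\<forall>i\<le>2*n. q i = p i) \<and>
      ball_of (p (2 * m)) \<inter> ball_of (q (2 * m)) = {}" if p: "legal_play G p" for p n
  proof -
    \<comment> \<open>The prefix of length \<open>Suc (2 * n)\<close> includes the move with index
      \<open>2 * n\<close>, so both plays still share the ball of the current stage.\<close>
    obtain q where q: "legal_play G q" "prefix_of q (Suc (2 * n)) = prefix_of p (Suc (2 * n))"
      "outcome q \<noteq> outcome p" using split[OF p] by blast
    obtain m where "n < m" "ball_of (p (2 * m)) \<inter> ball_of (q (2 * m)) = {}"
      using shrinking_separate[of p q n] shr p q by metis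
    then show ?thesis using q by (auto simp: prefix_of_eq_iff less_Suc_eq_le)
  qed
  then obtain F M where FM: "\<And>p n. legal_play G p \<Longrightarrow> legal_play G (F p n)"
    "\<And>p n. legal_play G p \<Longrightarrow> n < M p n"
    "\<And>p n i. legal_play G p \<Longrightarrow> i \<le> 2 * n \<Longrightarrow> F p n i = p i"
    "\<And>p n. legal_play G p \<Longrightarrow> ball_of (p (2 * M p n)) \<inter> ball_of (F p n (2 * M p n)) = {}"
    by metis
  \<comment> \<open>A node of the binary tree is a play together with a stage. The bit chooses
    between keeping the play and switching to its split partner; both children proceed to the same
    stage, where their balls are disjoint.\<close>
  define st :: "(nat \<Rightarrow> bool) \<Rightarrow> nat \<Rightarrow> (nat \<Rightarrow> 'a fball) \<times> nat" where
    "st = (\<lambda>a. rec_nat (p0, 0) (\<lambda>j s. (if a j then F (fst s) (snd s) else fst s, M (fst s) (snd s))))"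
  define P N where "P = (\<lambda>a j. fst (st a j))" and "N = (\<lambda>a j. snd (st a j))"
  have P0: "P a 0 = p0" for a by (simp add: P_def st_def)
  have PS: "P a (Suc j) = (if a j then F (P a j) (N a j) else P a j)" for a j
    by (simp add: P_def N_def st_def)
  have NS: "N a (Suc j) = M (P a j) (N a j)" for a j by (simp add: P_def N_def st_def)
  have legP: "legal_play G (P a j)" for a j
    by (induction j) (auto simp: P0 PS p0 FM(1))
  have N_less: "N a j < N a (Suc j)" for a j using FM(2) legP NS by simp
  have N_mono: "N a j \<le> N a k" if "j \<le> k" for a j k
    using lift_Suc_mono_le[of "N a"] N_less that by (meson less_imp_le)
  have N_ge: "j \<le> N a j" for a j
    by (induction j) (use N_less in \<open>auto intro: Suc_leI le_less_trans\<close>)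
  have agree: "P a k i = P a j i" if "j \<le> k" "i \<le> 2 * N a j" for a j k i
    using that
  proof (induction rule: dec_induct)
    case (step k)
    then have "i \<le> 2 * N a k" using N_mono[of j k a] by linarith
    then show ?case using step FM(3)[OF legP] by (auto simp: PS)
  qed simp
  \<comment> \<open>Because of \<open>j \<le> N a j\<close>, later splits no longer change index
    \<open>j\<close> of \<open>P a j\<close>, so the diagonal is the limit play of the
    branch.\<close>
  define r where "r = (\<lambda>a i. P a i i)"
  have r_eq: "r a i = P a j i" if "i \<le> 2 * N a j" for a i j
  proof (cases "i \<le> j")
    case True
    then show ?thesis using agree[of i j i a] N_ge[of i a] by (simp add: r_def)
  next
    case False
    then show ?thesis using agree[of j i i a] that by (simp add: r_def)
  qed
  have legr: "legal_play G (r a)" for a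
    unfolding legal_play_iff
  proof
    fix n
    have "r a i = P a n i" if "i \<le> n" for i
      using r_eq[of i a n] N_ge[of n a] that by linarith
    then have "prefix_of (r a) n = prefix_of (P a n) n" "r a n = P a n n"
      by (auto simp: prefix_of_eq_iff)
    then show "legal_move G (prefix_of (r a) n) (r a n)"
      using legP[of a n] by (simp add: legal_play_iff)
  qed
  define f where "f = (\<lambda>a. THE x. outcome (r a) = {x})"
  have out: "outcome (r a) = {f a}" for a
  proof -
    obtain x where "outcome (r a) = {x}" using shrinking_outcome[OF shr[OF legr]] by blast
    then show ?thesis by (simp add: f_def)
  qed
  define B where "B = (\<lambda>a j. ball_of (P a j (2 * N a j)))"
  have Br: "B a j = ball_of (r a (2 * N a j))" for a j using r_eq[of "2 * N a j" a j] by (simp add: B_def)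
  have st_cong: "st a n = st b n" if "\<forall>i<n. a i = b i" for a b n
    using that by (induction n) (auto simp: st_def)
  have "perfect_subset (range f)"
  proof (rule perfect_range_cantor_scheme[where B = B])
    show "B a n = B b n" if "\<forall>i<n. a i = b i" for a b n
      using st_cong[OF that] by (simp add: B_def P_def N_def)
    show "closed (B a n)" for a n by (simp add: B_def ball_of_def)
    show mem: "f a \<in> B a n" for a n using out[of a] by (auto simp: Br outcome_def)
    show "\<exists>n. \<forall>x\<in>B a n. dist x (f a) < e" if "e > 0" for a e
    proof -
      have "strict_mono (N a)" using N_less by (simp add: strict_mono_Suc_iff)
      moreover have "(\<lambda>n. snd (r a (2 * n))) \<longlonglongrightarrow> 0"
        using shr[OF legr] by (simp add: shrinking_def)
      ultimately have "(\<lambda>j. snd (r a (2 * N a j))) \<longlonglongrightarrow> 0"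
        using LIMSEQ_subseq_LIMSEQ[of "\<lambda>n. snd (r a (2 * n))" 0 "N a"] by (simp add: o_def)
      then have "\<forall>\<^sub>F j in sequentially. snd (r a (2 * N a j)) < e / 2"
        using order_tendstoD(2) that by (metis half_gt_zero)
      then obtain j where j: "snd (r a (2 * N a j)) < e / 2"
        by (metis (mono_tags, lifting) eventually_happens' sequentially_bot)
      show ?thesis
      proof (intro exI[of _ j] ballI)
        fix x assume "x \<in> B a j"
        then show "dist x (f a) < e"
          using mem[of a j] j dist_triangle3[of x "f a" "fst (r a (2 * N a j))"]
          by (simp add: Br ball_of_def)
      qed
    qed
    show "B a (Suc n) \<inter> B b (Suc n) = {}" if "\<forall>i<n. a i = b i" "a n \<noteq> b n" for a b n
    proof -
      have "P b n = P a n" "N b n = N a n" using st_cong[OF that(1)] by (auto simp: P_def N_def)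
      then show ?thesis
        using FM(4)[OF legP[of a n], of "N a n"] that(2) by (auto simp: B_def PS NS)
    qed
  qed
  then show ?thesis using that[of "range f"] out legr by blast
qed


section \<open>Restricting a game to the plays that follow a strategy\<close>

text \<open>Besides fixing the moves of \<open>P\<close>, the moves of the opponent are confined to \<open>R\<close>: this is
  what makes all remaining plays shrink to a point.\<close>

definition restricted ::
  "'m game \<Rightarrow> player \<Rightarrow> ('m list \<Rightarrow> 'm) \<Rightarrow> ('m list \<Rightarrow> 'm \<Rightarrow> bool) \<Rightarrow> 'm game" where
  "restricted G P \<sigma> R =
     G\<lparr>legal_move := \<lambda>h m. legal_move G h m \<and> (if to_move h = P then m = \<sigma> h else R h m)\<rparr>"

lemma legal_move_restricted [simp]:
  "legal_move (restricted G P \<sigma> R) h m \<longleftrightarrow>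
     legal_move G h m \<and> (if to_move h = P then m = \<sigma> h else R h m)"
  by (simp add: restricted_def)

lemma legal_history_restrictedD:
  assumes "legal_history (restricted G P \<sigma> R) h"
  shows "legal_history G h" "follows P \<sigma> h"
  using assms by (auto simp: legal_history_def follows_def split: if_splits)

lemma restricted_owner_move:
  assumes "winning_strategy G P \<sigma>" "legal_history (restricted G P \<sigma> R) h" "to_move h = P"
  shows "legal_move (restricted G P \<sigma> R) h (\<sigma> h)"
  using assms legal_history_restrictedD[OF assms(2)]
  by (auto simp: winning_strategy_def strategy_def)

lemma restricted_won_by:
  assumes "winning_strategy G P \<sigma>" "legal_play (restricted G P \<sigma> R) p"
  shows "won_by G P p"
proof -
  have "legal_history G (prefix_of p n)" "follows P \<sigma> (prefix_of p n)" for n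
    using assms(2) legal_history_restrictedD[of G P \<sigma> R] unfolding legal_play_def by blast+
  then show ?thesis using assms(1) by (auto simp: winning_strategy_def legal_play_def)
qed

lemma restricted_extend:
  assumes "winning_strategy G P \<sigma>"
    and move: "\<forall>h. legal_history (restricted G P \<sigma> R) h \<and> to_move h \<noteq> P \<longrightarrow>
      (\<exists>m. legal_move G h m \<and> R h m)"
    and "legal_history (restricted G P \<sigma> R) h"
  obtains p where "legal_play (restricted G P \<sigma> R) p" "prefix_of p (length h) = h"
proof -
  let ?G = "restricted G P \<sigma> R"
  have "\<exists>m. legal_history ?G (h @ [m])" if h: "legal_history ?G h" for h
  proof (cases "to_move h = P")
    case True
    then have "legal_move ?G h (\<sigma> h)" using restricted_owner_move[OF assms(1) h] by blast
    then show ?thesis using h legal_history_snoc[of ?G h] by blast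
  next
    case False
    then obtain m where "legal_move G h m" "R h m" using move h by blast
    then show ?thesis using False h by (auto simp: legal_history_snoc)
  qed
  then obtain p where "legal_play ?G p" "prefix_of p (length h) = h"
    using extend_to_legal_play[of "legal_history ?G" h ?G, OF assms(3)] by metis
  then show ?thesis by (rule that)
qed

text \<open>The winning condition enters only through \<open>wins\<close>, on plays with a one-point
  outcome. There Schmidt's criterion and the intersection criterion coincide, so that one argument
  serves all three games.\<close>

lemma bernstein_no_winning_strategy:
  fixes G :: "'a::complete_space fball game" and P \<sigma> R
  defines "H \<equiv> restricted G P \<sigma> R"
  assumes S: "bernstein S"
    and wins: "\<And>p x. outcome p = {x} \<Longrightarrow> alice_wins G p \<longleftrightarrow> x \<in> S"
    and ws: "winning_strategy G P \<sigma>"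
    and move: "\<And>h. legal_history H h \<Longrightarrow> to_move h \<noteq> P \<Longrightarrow> \<exists>m. legal_move G h m \<and> R h m"
    and shr: "\<And>p. legal_play H p \<Longrightarrow> shrinking p"
    and dodge: "\<And>h z. legal_history H h \<Longrightarrow> to_move h = Alice \<Longrightarrow> snd (last h) \<le> 1 \<Longrightarrow>
      \<exists>p. legal_play H p \<and> prefix_of p (length h) = h \<and> z \<notin> outcome p"
  shows False
proof -
  obtain p0 where p0: "legal_play H p0"
    using restricted_extend[OF ws _ legal_history_Nil, of R] move unfolding H_def by metis
  have split: "\<exists>q. legal_play H q \<and> prefix_of q n = prefix_of p n \<and> outcome q \<noteq> outcome p"
    if p: "legal_play H p" for p n
  proof -
    obtain z where z: "outcome p = {z}" using shrinking_outcome shr p by metis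
    \<comment> \<open>\<open>dodge\<close> covers only balls of radius at most 1, so the branching
      position is taken both that late and beyond \<open>n\<close>.\<close>
    have "(\<lambda>m. snd (p (2 * m))) \<longlonglongrightarrow> 0" using shr[OF p] by (simp add: shrinking_def)
    then have "\<forall>\<^sub>F m in sequentially. snd (p (2 * m)) < 1" by (rule order_tendstoD(2)) simp
    then obtain N where "\<forall>m\<ge>N. snd (p (2 * m)) < 1" by (auto simp: eventually_sequentially)
    then obtain m where m: "n \<le> m" "snd (p (2 * m)) < 1" by (meson linear)
    define h where "h = prefix_of p (Suc (2 * m))"
    have "legal_history H h" using p by (auto simp: h_def legal_play_def)
    moreover have "to_move h = Alice" "snd (last h) \<le> 1"
      using m by (auto simp: h_def to_move_def prefix_of_Suc)
    ultimately obtain q where q: "legal_play H q" "prefix_of q (length h) = h" "z \<notin> outcome q"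
      using dodge by metis
    have "prefix_of q (Suc (2 * m)) = prefix_of p (Suc (2 * m))" using q(2) by (simp add: h_def)
    then have "prefix_of q n = prefix_of p n" using m(1) by (simp add: prefix_of_eq_iff)
    then show ?thesis using q z by blast
  qed
  obtain K where K: "perfect_subset K" "\<And>x. x \<in> K \<Longrightarrow> \<exists>p. legal_play H p \<and> outcome p = {x}"
    using perfect_set_of_outcomes[OF p0 shr split] by metis
  \<comment> \<open>All points of \<open>K\<close> are outcomes won by the same player, so
    \<open>K\<close> lies in \<open>S\<close> or in its complement.\<close>
  have "(x \<in> S) = (P = Alice)" if "x \<in> K" for x
  proof -
    obtain p where p: "legal_play H p" "outcome p = {x}" using K(2) \<open>x \<in> K\<close> by blast
    then have "won_by G P p" using restricted_won_by ws by (auto simp: H_def)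
    then show ?thesis using wins[OF p(2)] by (auto simp: won_by_def split: if_splits)
  qed
  then show False using S K(1) unfolding bernstein_def by blast
qed


section \<open>Schmidt's game and the strong winning game\<close>

definition ratio :: "real \<Rightarrow> real \<Rightarrow> player \<Rightarrow> real" where
  "ratio \<alpha> \<beta> Q = (if Q = Alice then \<alpha> else \<beta>)"

text \<open>The player moving from \<open>\<omega>\<close> with ratio \<open>\<gamma>\<close> can ensure that the reply of an opponent with
  ratio at least \<open>a\<close> satisfies \<open>I\<close>.\<close>

definition forces :: "real \<Rightarrow> real \<Rightarrow> ('a::metric_space fball \<Rightarrow> bool) \<Rightarrow> 'a fball \<Rightarrow> bool" where
  "forces \<gamma> a I \<omega> \<longleftrightarrow>
     (\<exists>y. dist (fst \<omega>) y \<le> (1 - \<gamma>) * snd \<omega> \<and>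
       (\<forall>\<omega>'. 0 < snd \<omega>' \<and> a * (\<gamma> * snd \<omega>) \<le> snd \<omega>' \<and> fball_le \<omega>' (y, \<gamma> * snd \<omega>) \<longrightarrow> I \<omega>'))"

text \<open>Legality in \<open>G\<close> is squeezed between the two rules. From the owner of the
  strategy only the inequalities of the strong game are used, while the opponent plays by Schmidt's
  equalities; both games are thus treated at once.\<close>

locale ratio_game =
  fixes \<alpha> \<beta> :: real and S :: "'a::complete_space set" and G :: "'a fball game"
    and P :: player and \<sigma> :: "'a fball list \<Rightarrow> 'a fball"
  assumes ratios: "0 < \<alpha>" "\<alpha> < 1" "0 < \<beta>" "\<beta> < 1"
    and strong: "\<And>h \<omega>. legal_move G h \<omega> \<Longrightarrow> legal_move (strong_game \<alpha> \<beta> S) h \<omega>"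
    and schmidt: "\<And>h \<omega>. legal_move (schmidt_game \<alpha> \<beta> S) h \<omega> \<Longrightarrow> legal_move G h \<omega>"
    and wins: "\<And>p x. outcome p = {x} \<Longrightarrow> alice_wins G p \<longleftrightarrow> x \<in> S"
    and ws: "winning_strategy G P \<sigma>"
begin

definition "H = restricted G P \<sigma> (legal_move (schmidt_game \<alpha> \<beta> S))"

definition "\<gamma> = ratio \<alpha> \<beta> (if P = Alice then Bob else Alice)"

lemma \<gamma>: "0 < \<gamma>" "\<gamma> < 1"
  using ratios by (auto simp: \<gamma>_def ratio_def)

lemma ratio_opponent: "Q \<noteq> P \<Longrightarrow> ratio \<alpha> \<beta> Q = \<gamma>"
  unfolding \<gamma>_def by (cases Q; cases P) auto

lemma H_move_strong:
  assumes "legal_move H h \<omega>"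
  shows "0 < snd \<omega>" and "h \<noteq> [] \<Longrightarrow> fball_le \<omega> (last h)"
    and "h \<noteq> [] \<Longrightarrow> ratio \<alpha> \<beta> (to_move h) * snd (last h) \<le> snd \<omega>"
  using strong[of h \<omega>] assms
  by (auto simp: H_def strong_game_def formal_balls_def ratio_def split: if_splits)

lemma H_opponent_move_ratio:
  assumes "legal_move H h \<omega>" "to_move h \<noteq> P" "h \<noteq> []"
  shows "snd \<omega> = \<gamma> * snd (last h)"
  using assms ratio_opponent[of "to_move h"] by (auto simp: H_def schmidt_game_def ratio_def)

lemma H_opponent_moveI:
  assumes "to_move h \<noteq> P" "h \<noteq> []" "0 < snd (last h)"
    and "dist (fst (last h)) y \<le> (1 - \<gamma>) * snd (last h)"
  shows "legal_move H h (y, \<gamma> * snd (last h))"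
proof -
  have "legal_move (schmidt_game \<alpha> \<beta> S) h (y, \<gamma> * snd (last h))"
    using assms \<gamma> ratio_opponent[of "to_move h"]
    by (simp add: schmidt_game_def formal_balls_def fball_le_def ratio_def algebra_simps)
  then show ?thesis using schmidt assms(1) by (simp add: H_def)
qed

lemma H_history_pos:
  assumes "legal_history H h" "h \<noteq> []"
  shows "0 < snd (last h)"
  using assms H_move_strong(1)[of "butlast h" "last h"] legal_history_snoc[of H "butlast h" "last h"]
  by simp

lemma H_opponent_can_move:
  assumes "legal_history H h" "to_move h \<noteq> P"
  shows "\<exists>\<omega>. legal_move H h \<omega>"
proof (cases "h = []")
  case True
  have "legal_move (schmidt_game \<alpha> \<beta> S) h (undefined, 1)"
    using True by (simp add: schmidt_game_def formal_balls_def)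
  then have "legal_move H h (undefined, 1)" using schmidt assms(2) by (simp add: H_def)
  then show ?thesis by blast
next
  case False
  have "dist (fst (last h)) (fst (last h)) \<le> (1 - \<gamma>) * snd (last h)"
    using \<gamma> H_history_pos[OF assms(1) False] by simp
  then show ?thesis
    using H_opponent_moveI[OF assms(2) False H_history_pos[OF assms(1) False]] by blast
qed

lemma H_play_nested:
  assumes "legal_play H p"
  shows "fball_le (p (Suc n)) (p n)"
proof -
  have "legal_move H (prefix_of p (Suc n)) (p (Suc n))"
    using assms unfolding legal_play_iff by blast
  from H_move_strong(2)[OF this] show ?thesis by (simp add: prefix_of_Suc)
qed

text \<open>The owner of the strategy may shrink arbitrarily little in the strong game, but one of
  any two consecutive moves is the opponent's and contracts by exactly
  \<open>\<gamma>\<close>.\<close>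

lemma H_play_shrinks:
  assumes "legal_play H p"
  shows "(\<lambda>n. snd (p n)) \<longlonglongrightarrow> 0"
proof -
  have pos: "0 < snd (p n)" for n
    using H_move_strong(1) assms unfolding legal_play_iff by blast
  have le: "snd (p (Suc n)) \<le> snd (p n)" for n
    using H_play_nested[OF assms] fball_le_snd by blast
  have opp: "snd (p (Suc n)) = \<gamma> * snd (p n)" if "to_move (prefix_of p (Suc n)) \<noteq> P" for n
  proof -
    have "legal_move H (prefix_of p (Suc n)) (p (Suc n))"
      using assms unfolding legal_play_iff by blast
    from H_opponent_move_ratio[OF this that] show ?thesis by (simp add: prefix_of_Suc)
  qed
  have step: "snd (p (Suc (Suc n))) \<le> \<gamma> * snd (p n)" for n
  proof (cases "to_move (prefix_of p (Suc n)) = P")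
    case True
    then have "to_move (prefix_of p (Suc (Suc n))) \<noteq> P"
      by (auto simp: to_move_def split: if_splits)
    then show ?thesis using opp[of "Suc n"] le[of n] \<gamma> by simp
  next
    case False
    then show ?thesis using opp[of n] le[of "Suc n"] by simp
  qed
  have geo: "snd (p (2 * n)) \<le> \<gamma> ^ n * snd (p 0)" for n
  proof (induction n)
    case (Suc n)
    have "snd (p (2 * Suc n)) \<le> \<gamma> * snd (p (2 * n))" using step[of "2 * n"] by simp
    also have "\<dots> \<le> \<gamma> * (\<gamma> ^ n * snd (p 0))" using Suc \<gamma> by simp
    finally show ?case by simp
  qed simp
  have "(\<lambda>n. \<gamma> ^ n * snd (p 0)) \<longlonglongrightarrow> 0"
    using \<gamma> by (intro tendsto_mult_left_zero LIMSEQ_realpow_zero) auto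
  then have even: "(\<lambda>n. snd (p (2 * n))) \<longlonglongrightarrow> 0"
    by (rule tendsto_sandwich[of "\<lambda>_. 0", rotated -1])
      (use pos geo in \<open>auto simp: less_imp_le\<close>)
  have "decseq (\<lambda>n. snd (p n))" using le by (rule decseq_SucI)
  then obtain L where L: "(\<lambda>n. snd (p n)) \<longlonglongrightarrow> L"
    using decseq_convergent[of "\<lambda>n. snd (p n)" 0] pos less_imp_le by metis
  moreover have "strict_mono (\<lambda>n. 2 * n :: nat)" by (simp add: strict_mono_def)
  ultimately have "(\<lambda>n. snd (p (2 * n))) \<longlonglongrightarrow> L"
    using LIMSEQ_subseq_LIMSEQ[of "\<lambda>n. snd (p n)" L "\<lambda>n. 2 * n"] by (simp add: o_def)
  then show ?thesis using L even LIMSEQ_unique by blast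
qed

text \<open>\<open>I\<close> is an invariant of the owner's replies that the opponent restores in
  every round. It keeps the centres at distance \<open>\<delta>\<close> from \<open>z\<close>,
  whereas \<open>z\<close> in the outcome would be within radii tending to 0.\<close>

lemma dodge:
  assumes h: "legal_history H h" "h \<noteq> []" "to_move h \<noteq> P"
    and start: "forces \<gamma> (ratio \<alpha> \<beta> P) I (last h)"
    and keep: "\<And>\<omega>. 0 < snd \<omega> \<Longrightarrow> I \<omega> \<Longrightarrow> forces \<gamma> (ratio \<alpha> \<beta> P) I \<omega>"
    and far: "0 < \<delta>" "\<And>\<omega>. 0 < snd \<omega> \<Longrightarrow> I \<omega> \<Longrightarrow> \<delta> \<le> dist (fst \<omega>) z"
  shows "\<exists>p. legal_play H p \<and> prefix_of p (length h) = h \<and> z \<notin> outcome p"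
proof -
  let ?a = "ratio \<alpha> \<beta> P"
  \<comment> \<open>When the owner is to move, every admissible reply must already satisfy
    \<open>I\<close>, since nothing is known about the strategy.\<close>
  define Q where "Q = (\<lambda>g. legal_history H g \<and> g \<noteq> [] \<and>
    (if to_move g = P
     then (\<forall>\<omega>. 0 < snd \<omega> \<and> ?a * snd (last g) \<le> snd \<omega> \<and> fball_le \<omega> (last g) \<longrightarrow> I \<omega>)
     else forces \<gamma> ?a I (last g)))"
  have "Q h" using h start by (simp add: Q_def)
  moreover have "\<exists>\<omega>. Q (g @ [\<omega>])" if g: "Q g" for g
  proof (cases "to_move g = P")
    case True
    have lg: "legal_history H g" "g \<noteq> []" using g by (auto simp: Q_def)
    have m: "legal_move H g (\<sigma> g)"
      using restricted_owner_move[OF ws lg(1)[unfolded H_def] True] by (simp add: H_def)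
    have "\<forall>\<omega>. 0 < snd \<omega> \<and> ?a * snd (last g) \<le> snd \<omega> \<and> fball_le \<omega> (last g) \<longrightarrow> I \<omega>"
      using g True by (simp add: Q_def)
    then have "I (\<sigma> g)" using H_move_strong[OF m] lg(2) True by blast
    then have "Q (g @ [\<sigma> g])"
      using lg m keep H_move_strong(1)[OF m] True
      by (auto simp: Q_def legal_history_snoc to_move_snoc split: if_splits)
    then show ?thesis by blast
  next
    case False
    have lg: "legal_history H g" "g \<noteq> []" "forces \<gamma> ?a I (last g)" using g False by (auto simp: Q_def)
    then obtain y where y: "dist (fst (last g)) y \<le> (1 - \<gamma>) * snd (last g)"
      "\<forall>\<omega>'. 0 < snd \<omega>' \<and> ?a * (\<gamma> * snd (last g)) \<le> snd \<omega>' \<and>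
        fball_le \<omega>' (y, \<gamma> * snd (last g)) \<longrightarrow> I \<omega>'"
      by (auto simp: forces_def)
    have "legal_move H g (y, \<gamma> * snd (last g))"
      using H_opponent_moveI[OF False lg(2) H_history_pos[OF lg(1,2)] y(1)] .
    moreover have "to_move (g @ [(y, \<gamma> * snd (last g))]) = P"
      using False by (cases P) (auto simp: to_move_def split: if_splits)
    ultimately have "Q (g @ [(y, \<gamma> * snd (last g))])"
      using y(2) lg by (simp add: Q_def legal_history_snoc)
    then show ?thesis by blast
  qed
  moreover have "\<And>g. Q g \<Longrightarrow> legal_history H g" by (simp add: Q_def)
  ultimately obtain p where p: "legal_play H p" "prefix_of p (length h) = h"
    "\<And>n. length h \<le> n \<Longrightarrow> Q (prefix_of p n)"
    using extend_to_legal_play[of Q h H] by metis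
  have "z \<notin> outcome p"
  proof
    assume z: "z \<in> outcome p"
    have "dist (fst (p n)) z \<le> snd (p n)" for n
    proof -
      have "fball_le (p (2 * n)) (p n)"
        using fball_le_chain[of p n "2 * n"] H_play_nested[OF p(1)] by simp
      moreover have "z \<in> ball_of (p (2 * n))" using z unfolding outcome_def by blast
      ultimately have "z \<in> ball_of (p n)" using fball_le_ball_of by blast
      then show ?thesis by (simp add: ball_of_def)
    qed
    moreover obtain N where N: "snd (p n) < \<delta>" if "n \<ge> N" for n
      using order_tendstoD(2)[OF H_play_shrinks[OF p(1)] far(1)]
      by (auto simp: eventually_sequentially)
    ultimately have close: "dist (fst (p n)) z < \<delta>" if "n \<ge> N" for n
      using that le_less_trans by blast
    \<comment> \<open>Only the owner's moves are known to satisfy \<open>I\<close>, so one of two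
      consecutive late indices is picked by parity.\<close>
    obtain n where n: "n \<ge> N" "n \<ge> length h" "to_move (prefix_of p n) = P"
    proof (cases "to_move (prefix_of p (N + length h)) = P")
      case True
      then show ?thesis using that[of "N + length h"] by simp
    next
      case False
      then have "to_move (prefix_of p (Suc (N + length h))) = P"
        by (cases P) (auto simp: to_move_def split: if_splits)
      then show ?thesis using that[of "Suc (N + length h)"] by simp
    qed
    have "legal_move H (prefix_of p n) (p n)" using p(1) by (simp add: legal_play_iff)
    note m = H_move_strong[OF this]
    have "prefix_of p n \<noteq> []" "\<forall>\<omega>. 0 < snd \<omega> \<and> ?a * snd (last (prefix_of p n)) \<le> snd \<omega> \<and>
        fball_le \<omega> (last (prefix_of p n)) \<longrightarrow> I \<omega>"
      using p(3)[OF n(2)] n(3) by (simp_all add: Q_def)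
    then have "I (p n)" using n(3) m by blast
    then have "\<delta> \<le> dist (fst (p n)) z" using far(2) m(1) by blast
    then show False using close n(1) by fastforce
  qed
  then show ?thesis using p by blast
qed

lemma no_bernstein:
  assumes "bernstein S"
    and evade: "\<And>(x::'a) \<rho> z. 0 < \<rho> \<Longrightarrow> \<rho> \<le> 1 \<Longrightarrow> \<exists>I \<delta>. forces \<gamma> (ratio \<alpha> \<beta> P) I (x, \<rho>) \<and>
      (\<forall>\<omega>. 0 < snd \<omega> \<and> I \<omega> \<longrightarrow> forces \<gamma> (ratio \<alpha> \<beta> P) I \<omega>) \<and>
      0 < \<delta> \<and> (\<forall>\<omega>. 0 < snd \<omega> \<and> I \<omega> \<longrightarrow> \<delta> \<le> dist (fst \<omega>) z)"
  shows False
proof (rule bernstein_no_winning_strategy[where G = G and P = P and \<sigma> = \<sigma>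
      and R = "legal_move (schmidt_game \<alpha> \<beta> S)", folded H_def])
  show "bernstein S" "winning_strategy G P \<sigma>" by (rule \<open>bernstein S\<close>, rule ws)
  show "alice_wins G p \<longleftrightarrow> x \<in> S" if "outcome p = {x}" for p x using wins[OF that] .
  show "\<exists>m. legal_move G h m \<and> legal_move (schmidt_game \<alpha> \<beta> S) h m"
    if "legal_history H h" "to_move h \<noteq> P" for h
    using H_opponent_can_move[OF that] that(2) by (simp add: H_def)
  show "shrinking p" if p: "legal_play H p" for p
  proof -
    have "fball_le (p (2 * Suc n)) (p (2 * n))" for n
      using fball_le_chain[of p "2 * n" "2 * Suc n"] H_play_nested[OF p] by simp
    moreover have "strict_mono (\<lambda>n. 2 * n :: nat)" by (simp add: strict_mono_def)
    then have "(\<lambda>n. snd (p (2 * n))) \<longlonglongrightarrow> 0"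
      using LIMSEQ_subseq_LIMSEQ[OF H_play_shrinks[OF p]] by (simp add: o_def)
    ultimately show ?thesis by (simp add: shrinking_def)
  qed
  show "\<exists>p. legal_play H p \<and> prefix_of p (length h) = h \<and> z \<notin> outcome p"
    if h: "legal_history H h" "to_move h = Alice" "snd (last h) \<le> 1" for h z
  proof -
    have dodge': "\<exists>p. legal_play H p \<and> prefix_of p (length g) = g \<and> z \<notin> outcome p"
      if g: "legal_history H g" "g \<noteq> []" "to_move g \<noteq> P" "snd (last g) \<le> 1" for g
    proof -
      obtain I \<delta> where "forces \<gamma> (ratio \<alpha> \<beta> P) I (last g)"
        "\<forall>\<omega>. 0 < snd \<omega> \<and> I \<omega> \<longrightarrow> forces \<gamma> (ratio \<alpha> \<beta> P) I \<omega>"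
        "0 < \<delta>" "\<forall>\<omega>. 0 < snd \<omega> \<and> I \<omega> \<longrightarrow> \<delta> \<le> dist (fst \<omega>) z"
        using evade[OF H_history_pos[OF g(1,2)] g(4), of "fst (last g)" z] by auto
      then show ?thesis using dodge[OF g(1-3), of I \<delta> z] by blast
    qed
    have ne: "h \<noteq> []" using h(2) by (auto simp: to_move_def)
    show ?thesis
    proof (cases "P = Alice")
      case False
      then have "to_move h \<noteq> P" using h(2) by simp
      then show ?thesis using dodge'[OF h(1) ne _ h(3)] by blast
    next
      \<comment> \<open>Dodging begins with a move of the opponent. If Alice owns the strategy, her
        prescribed answer is appended first; it does not enlarge the radius.\<close>
      case True
      then have "to_move h = P" using h(2) by simp
      note m = restricted_owner_move[OF ws h(1)[unfolded H_def] this, folded H_def]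
      have "snd (\<sigma> h) \<le> 1" using H_move_strong(2)[OF m ne] fball_le_snd h(3) by fastforce
      moreover have "to_move (h @ [\<sigma> h]) \<noteq> P" using h(2) True by (simp add: to_move_snoc)
      ultimately obtain p where p: "legal_play H p"
        "prefix_of p (Suc (length h)) = h @ [\<sigma> h]" "z \<notin> outcome p"
        using dodge'[of "h @ [\<sigma> h]"] h(1) m by (auto simp: legal_history_snoc)
      then have "prefix_of p (length h) = h" by (simp add: prefix_of_Suc)
      then show ?thesis using p by blast
    qed
  qed
qed

end

text \<open>\<open>\<gamma>\<close> is the ratio of the opponent and \<open>a\<close> that of the
  strategy's owner. Either player may be the owner, hence both pairs.\<close>

lemma ratio_games_undetermined:
  fixes S :: "'a::complete_space set"
  assumes "0 < \<alpha>" "\<alpha> < 1" "0 < \<beta>" "\<beta> < 1" "bernstein S"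
    and evade: "\<And>\<gamma> a x \<rho> z. (\<gamma>, a) \<in> {(\<alpha>, \<beta>), (\<beta>, \<alpha>)} \<Longrightarrow> 0 < \<rho> \<Longrightarrow> \<rho> \<le> 1 \<Longrightarrow>
      \<exists>I \<delta>. forces \<gamma> a I (x, \<rho>) \<and>
      (\<forall>\<omega>::'a fball. 0 < snd \<omega> \<and> I \<omega> \<longrightarrow> forces \<gamma> a I \<omega>) \<and>
      0 < \<delta> \<and> (\<forall>\<omega>. 0 < snd \<omega> \<and> I \<omega> \<longrightarrow> \<delta> \<le> dist (fst \<omega>) z)"
  shows "undetermined (schmidt_game \<alpha> \<beta> S)" "undetermined (strong_game \<alpha> \<beta> S)"
proof -
  have *: False if "ratio_game \<alpha> \<beta> S G P \<sigma>" for G P \<sigma>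
  proof -
    have "(ratio_game.\<gamma> \<alpha> \<beta> P, ratio \<alpha> \<beta> P) \<in> {(\<alpha>, \<beta>), (\<beta>, \<alpha>)}"
      unfolding ratio_game.\<gamma>_def[OF that] by (cases P) (auto simp: ratio_def)
    note evade' = evade[OF this]
    show False by (rule ratio_game.no_bernstein[OF that \<open>bernstein S\<close>]) (rule evade')
  qed
  have "ratio_game \<alpha> \<beta> S (schmidt_game \<alpha> \<beta> S) P \<sigma>"
    if "winning_strategy (schmidt_game \<alpha> \<beta> S) P \<sigma>" for P \<sigma>
    using assms that by unfold_locales (auto simp: schmidt_game_def strong_game_def)
  then show "undetermined (schmidt_game \<alpha> \<beta> S)" using * unfolding determined_def by blast
  have "ratio_game \<alpha> \<beta> S (strong_game \<alpha> \<beta> S) P \<sigma>"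
    if "winning_strategy (strong_game \<alpha> \<beta> S) P \<sigma>" for P \<sigma>
    using assms that by unfold_locales (auto simp: schmidt_game_def strong_game_def)
  then show "undetermined (strong_game \<alpha> \<beta> S)" using * unfolding determined_def by blast
qed


section \<open>Evading a point in the ratio games\<close>

lemma uniformly_perfectE:
  fixes x :: "'a::metric_space"
  assumes "uniformly_perfect c (UNIV :: 'a set)" "0 < r" "r \<le> 1"
  obtains y where "dist x y \<le> r" "c * r < dist x y"
proof -
  have "cball x r - cball x (c * r) \<noteq> {}"
    using assms by (auto simp: uniformly_perfect_def)
  then obtain y where "y \<in> cball x r" "y \<notin> cball x (c * r)" by blast
  then show ?thesis using that[of y] by simp
qed

text \<open>The bound on \<open>\<gamma>\<close> says
  \<open>\<gamma> < c * (1 - 2 * \<gamma>)\<close>. If \<open>z\<close> is within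
  \<open>\<gamma> * \<rho>\<close> of \<open>x\<close>, uniform perfectness around \<open>z\<close>
  at radius \<open>(1 - 2 * \<gamma>) * \<rho>\<close> gives a centre still within
  \<open>(1 - \<gamma>) * \<rho>\<close> of \<open>x\<close> whose ball of radius
  \<open>\<gamma> * \<rho>\<close> misses \<open>z\<close>. The margin \<open>\<delta>\<close>
  survives in all smaller balls, so afterwards the opponent just keeps the centre.\<close>

lemma uniformly_perfect_evade:
  fixes x :: "'a::metric_space"
  assumes up: "uniformly_perfect c (UNIV :: 'a set)" and "0 < c"
    and \<gamma>: "0 < \<gamma>" "\<gamma> < c / (1 + 2 * c)" and \<rho>: "0 < \<rho>" "\<rho> \<le> 1"
  shows "\<exists>I \<delta>. forces \<gamma> a I (x, \<rho>) \<and>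
      (\<forall>\<omega>. 0 < snd \<omega> \<and> I \<omega> \<longrightarrow> forces \<gamma> a I \<omega>) \<and>
      0 < \<delta> \<and> (\<forall>\<omega>. 0 < snd \<omega> \<and> I \<omega> \<longrightarrow> \<delta> \<le> dist (fst \<omega>) z)"
proof -
  have "\<gamma> * (1 + 2 * c) < c" using \<gamma>(2) \<open>0 < c\<close> by (simp add: pos_less_divide_eq)
  then have \<gamma>c: "\<gamma> < c * (1 - 2 * \<gamma>)" by (simp add: algebra_simps)
  then have "0 < c * (1 - 2 * \<gamma>)" using \<gamma>(1) by linarith
  then have \<gamma>2: "2 * \<gamma> < 1" using \<open>0 < c\<close> by (simp add: zero_less_mult_iff)
  obtain y where y: "dist x y \<le> (1 - \<gamma>) * \<rho>" "\<gamma> * \<rho> < dist y z"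
  proof (cases "\<gamma> * \<rho> < dist x z")
    case True
    then show ?thesis using that[of x] \<gamma>2 \<gamma>(1) \<rho>(1) by simp
  next
    case False
    have r: "0 < (1 - 2 * \<gamma>) * \<rho>" "(1 - 2 * \<gamma>) * \<rho> \<le> 1"
      using \<gamma>2 \<gamma>(1) \<rho> by (auto intro: mult_le_one)
    obtain y where y: "dist z y \<le> (1 - 2 * \<gamma>) * \<rho>" "c * ((1 - 2 * \<gamma>) * \<rho>) < dist z y"
      using uniformly_perfectE[OF up r] .
    have "\<gamma> * \<rho> < c * ((1 - 2 * \<gamma>) * \<rho>)"
      using mult_strict_right_mono[OF \<gamma>c \<rho>(1)] by (simp add: mult.assoc)
    moreover have "dist x y \<le> \<gamma> * \<rho> + (1 - 2 * \<gamma>) * \<rho>"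
      using False y(1) dist_triangle[of x y z] by linarith
    ultimately show ?thesis
      using that[of y] y(2) by (simp add: dist_commute algebra_simps)
  qed
  define \<delta> where "\<delta> = dist y z - \<gamma> * \<rho>"
  define I where "I = (\<lambda>\<omega>. \<delta> + snd \<omega> \<le> dist (fst \<omega>) z)"
  have "forces \<gamma> a I (x, \<rho>)"
    unfolding forces_def
  proof (intro exI[of _ y] conjI allI impI)
    show "dist (fst (x, \<rho>)) y \<le> (1 - \<gamma>) * snd (x, \<rho>)" using y by simp
    fix \<omega>' assume "0 < snd \<omega>' \<and> a * (\<gamma> * snd (x, \<rho>)) \<le> snd \<omega>' \<and> fball_le \<omega>' (y, \<gamma> * snd (x, \<rho>))"
    then show "I \<omega>'"
      using dist_triangle[of y z "fst \<omega>'"] by (simp add: I_def \<delta>_def fball_le_def)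
  qed
  moreover have "forces \<gamma> a I \<omega>" if \<omega>: "0 < snd \<omega>" "I \<omega>" for \<omega>
    unfolding forces_def
  proof (intro exI[of _ "fst \<omega>"] conjI allI impI)
    show "dist (fst \<omega>) (fst \<omega>) \<le> (1 - \<gamma>) * snd \<omega>" using \<omega>(1) \<gamma>2 \<gamma>(1) by simp
    fix \<omega>' assume "0 < snd \<omega>' \<and> a * (\<gamma> * snd \<omega>) \<le> snd \<omega>' \<and> fball_le \<omega>' (fst \<omega>, \<gamma> * snd \<omega>)"
    moreover have "\<gamma> * snd \<omega> \<le> snd \<omega>" using \<omega>(1) \<gamma>2 \<gamma>(1) by simp
    ultimately show "I \<omega>'"
      using \<omega>(2) dist_triangle[of "fst \<omega>" z "fst \<omega>'"] by (simp add: I_def fball_le_def)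
  qed
  moreover have "\<delta> \<le> dist (fst \<omega>) z" if "0 < snd \<omega>" "I \<omega>" for \<omega>
    using that by (simp add: I_def)
  moreover have "0 < \<delta>" using y(2) by (simp add: \<delta>_def)
  ultimately show ?thesis by blast
qed

section \<open>Evasion in Banach spaces\<close>

lemma direction_to:
  fixes x z :: "'a::real_normed_vector"
  assumes "\<exists>e::'a. e \<noteq> 0"
  obtains v where "norm v = 1" "z = x + dist x z *\<^sub>R v"
proof (cases "x = z")
  case True
  obtain e :: 'a where "e \<noteq> 0" using assms by blast
  then show ?thesis using that[of "sgn e"] True by (simp add: norm_sgn)
next
  case False
  then have "x + dist x z *\<^sub>R sgn (z - x) = z"
    by (simp add: sgn_div_norm dist_norm norm_minus_commute)
  then show ?thesis using that[of "sgn (z - x)"] False by (simp add: norm_sgn)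
qed

lemma banach_evade:
  fixes x :: "'a::banach"
  assumes ne: "\<exists>e::'a. e \<noteq> 0"
    and \<gamma>: "0 < \<gamma>" "\<gamma> < 1" "2 * \<gamma> < 1 + a * \<gamma>" and \<rho>: "0 < \<rho>"
  shows "\<exists>I \<delta>. forces \<gamma> a I (x, \<rho>) \<and>
      (\<forall>\<omega>. 0 < snd \<omega> \<and> I \<omega> \<longrightarrow> forces \<gamma> a I \<omega>) \<and>
      0 < \<delta> \<and> (\<forall>\<omega>. 0 < snd \<omega> \<and> I \<omega> \<longrightarrow> \<delta> \<le> dist (fst \<omega>) z)"
proof -
  \<comment> \<open>Retreating gains \<open>1 - \<gamma>\<close> radii. The reply keeps a radius of
    at least \<open>a * \<gamma>\<close>, so its centre can return by at most
    \<open>\<gamma> - a * \<gamma>\<close>; \<open>\<kappa>\<close> is the net gain per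
    round.\<close>
  define \<kappa> where "\<kappa> = 1 - 2 * \<gamma> + a * \<gamma>"
  have \<kappa>: "0 < \<kappa>" using \<gamma> by (simp add: \<kappa>_def)
  text \<open>Moving straight away from \<open>z\<close> gains more distance than the opponent can take back.\<close>
  have away: "forces \<gamma> a (\<lambda>\<omega>'. dist (fst \<omega>) z + \<kappa> * snd \<omega> \<le> dist (fst \<omega>') z) \<omega>"
    if \<omega>: "0 < snd \<omega>" for \<omega> :: "'a fball"
  proof -
    obtain v where v: "norm v = 1" "z = fst \<omega> + dist (fst \<omega>) z *\<^sub>R v"
      using direction_to[OF ne, of z "fst \<omega>"] .
    define r where "r = (1 - \<gamma>) * snd \<omega>"
    have r: "0 \<le> r" using \<gamma> \<omega> by (simp add: r_def)
    define y where "y = fst \<omega> - r *\<^sub>R v"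
    have yx: "dist (fst \<omega>) y = r" using r v(1) by (simp add: y_def dist_norm)
    have "y - z = - ((dist (fst \<omega>) z + r) *\<^sub>R v)"
      by (subst v(2)) (simp add: y_def algebra_simps)
    then have yz: "dist y z = dist (fst \<omega>) z + r"
      using r v(1) by (simp add: dist_norm)
    show ?thesis
      unfolding forces_def
    proof (intro exI[of _ y] conjI allI impI)
      show "dist (fst \<omega>) y \<le> (1 - \<gamma>) * snd \<omega>" using yx by (simp add: r_def)
      fix \<omega>' assume "0 < snd \<omega>' \<and> a * (\<gamma> * snd \<omega>) \<le> snd \<omega>' \<and> fball_le \<omega>' (y, \<gamma> * snd \<omega>)"
      then show "dist (fst \<omega>) z + \<kappa> * snd \<omega> \<le> dist (fst \<omega>') z"
        using yz dist_triangle[of y z "fst \<omega>'"] by (simp add: \<kappa>_def r_def fball_le_def algebra_simps)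
    qed
  qed
  define I where "I = (\<lambda>\<omega>::'a fball. \<kappa> * \<rho> \<le> dist (fst \<omega>) z)"
  have mono: "forces \<gamma> a J \<omega>" if "forces \<gamma> a J' \<omega>" "\<And>\<omega>'. J' \<omega>' \<Longrightarrow> J \<omega>'" for J J' and \<omega> :: "'a fball"
    using that unfolding forces_def by blast
  have "forces \<gamma> a I (x, \<rho>)"
  proof (rule mono[OF away])
    show "I \<omega>'" if "dist (fst (x, \<rho>)) z + \<kappa> * snd (x, \<rho>) \<le> dist (fst \<omega>') z" for \<omega>'
      using that zero_le_dist[of x z] unfolding I_def fst_conv snd_conv by linarith
  qed (simp add: \<rho>)
  moreover have "forces \<gamma> a I \<omega>" if \<omega>: "0 < snd \<omega>" "I \<omega>" for \<omega>
  proof (rule mono[OF away])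
    have "0 < \<kappa> * snd \<omega>" using \<kappa> \<omega>(1) by simp
    then show "I \<omega>'" if "dist (fst \<omega>) z + \<kappa> * snd \<omega> \<le> dist (fst \<omega>') z" for \<omega>'
      using that \<omega>(2) unfolding I_def by linarith
  qed (fact \<omega>(1))
  moreover have "0 < \<kappa> * \<rho>" using \<kappa> \<rho> by simp
  ultimately show ?thesis by (intro exI[of _ I] exI[of _ "\<kappa> * \<rho>"]) (auto simp: I_def)
qed


section \<open>The absolute winning game\<close>

lemma absolute_play:
  assumes "legal_play (absolute_game \<beta> S) p"
  shows "0 < snd (p n)" and "fball_le (p (2 * Suc n)) (p (2 * n))"
    and "ball_of (p (2 * Suc n)) \<inter> ball_of (p (Suc (2 * n))) = {}"
proof -
  have m: "legal_move (absolute_game \<beta> S) (prefix_of p n) (p n)" for n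
    using assms unfolding legal_play_iff by blast
  show "0 < snd (p n)"
    using m[of n] by (auto simp: absolute_game_def formal_balls_def)
  show "fball_le (p (2 * Suc n)) (p (2 * n))"
    "ball_of (p (2 * Suc n)) \<inter> ball_of (p (Suc (2 * n))) = {}"
    using m[of "Suc (Suc (2 * n))"] by (auto simp: absolute_game_def prefix_of_Suc to_move_def butlast_append)
qed

text \<open>A closed ball could have isolated points on its boundary even if the space has none; the
  closure of an open ball cannot.\<close>

lemma perfect_closure_ball:
  fixes x :: "'a::metric_space"
  assumes "\<And>y::'a. y islimpt UNIV" "0 < r"
  shows "perfect_subset (closure (ball x r))"
  unfolding perfect_subset_def
proof (intro conjI ballI)
  show "closure (ball x r) \<noteq> {}" using assms(2) by simp
  fix y assume y: "y \<in> closure (ball x r)"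
  have "y islimpt ball x r"
  proof (cases "y \<in> ball x r")
    case True
    then show ?thesis
      using assms(1)[of y] islimpt_Int_eventually[of y UNIV "ball x r"]
      by (metis Int_UNIV_left eventually_at_topological open_ball)
  next
    case False
    then show ?thesis using y by (simp add: closure_def)
  qed
  then show "y islimpt closure (ball x r)" using closure_subset islimpt_subset by blast
qed simp

lemma absolute_game_bob_cannot_win:
  fixes S :: "'a::complete_space set"
  assumes "0 < \<beta>" and S: "bernstein S" and lim: "\<And>y::'a. y islimpt UNIV"
  shows "\<not> winning_strategy (absolute_game \<beta> S) Bob \<sigma>"
proof
  let ?G = "absolute_game \<beta> S"
  assume ws: "winning_strategy ?G Bob \<sigma>"
  \<comment> \<open>Alice cannot make Bob's radii shrink, so \<open>R\<close> demands nothing; that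
    they do shrink is derived below from Bob winning every play.\<close>
  define R where "R = (\<lambda>(h :: 'a fball list) (m :: 'a fball). True)"
  define H where "H = restricted ?G Bob \<sigma> R"
  have H_play: "legal_play ?G p" if "legal_play H p" for p
    using that by (simp add: H_def legal_play_iff)
  have delete: "legal_move H h (z, \<beta> * snd (last h))"
    if h: "legal_history H h" "to_move h = Alice" for h z
  proof -
    have "h \<noteq> []" using h(2) by (auto simp: to_move_def)
    then have "legal_move ?G (butlast h) (last h)"
      using legal_history_snoc[of H "butlast h" "last h"] h(1) by (simp add: H_def)
    then have "0 < snd (last h)" by (auto simp: absolute_game_def formal_balls_def)
    then show ?thesis
      using h(2) \<open>0 < \<beta>\<close> by (simp add: H_def R_def absolute_game_def formal_balls_def)
  qed
  have mv: "\<exists>m. legal_move ?G h m \<and> R h m" if h: "legal_history H h" "to_move h \<noteq> Bob" for h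
  proof -
    have "to_move h = Alice" using h(2) by (cases "to_move h") auto
    from delete[OF h(1) this, of undefined] h(2) show ?thesis unfolding H_def by auto
  qed
  show False
  proof (rule bernstein_no_winning_strategy[where G = ?G and P = Bob and \<sigma> = \<sigma> and R = R,
        folded H_def])
    show "bernstein S" "winning_strategy ?G Bob \<sigma>" by (rule S, rule ws)
    show "alice_wins ?G p \<longleftrightarrow> x \<in> S" if "outcome p = {x}" for p x
      using that by (simp add: absolute_game_def)
    show "\<exists>m. legal_move ?G h m \<and> R h m" if "legal_history H h" "to_move h \<noteq> Bob" for h
      using mv[OF that] .
    show "shrinking p" if p: "legal_play H p" for p
    proof -
      note ap = absolute_play[OF H_play[OF p]]
      obtain x r where x: "(\<lambda>n. snd (p (2 * n))) \<longlonglongrightarrow> r"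
        "\<And>n. cball x r \<subseteq> ball_of (p (2 * n))" "0 \<le> r"
        using nested_fballs[of "\<lambda>n. p (2 * n)"] ap(1,2) less_imp_le by metis
      text \<open>Otherwise the outcome contains a ball, hence a point of \<open>S\<close>.\<close>
      have "r = 0"
      proof (rule ccontr)
        assume "r \<noteq> 0"
        then have "perfect_subset (closure (ball x r))"
          using x(3) by (intro perfect_closure_ball lim) simp
        then have "closure (ball x r) \<inter> S \<noteq> {}" using S by (auto simp: bernstein_def)
        moreover have "closure (ball x r) \<subseteq> cball x r"
          by (intro closure_minimal ball_subset_cball closed_cball)
        then have "closure (ball x r) \<subseteq> outcome p" using x(2) unfolding outcome_def by blast
        ultimately have "alice_wins ?G p" by (auto simp: absolute_game_def)
        then show False
          using restricted_won_by[OF ws p[unfolded H_def]] by (simp add: won_by_def)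
      qed
      then show ?thesis using x(1) ap(2) by (simp add: shrinking_def)
    qed
    show "\<exists>p. legal_play H p \<and> prefix_of p (length h) = h \<and> z \<notin> outcome p"
      if h: "legal_history H h" "to_move h = Alice" for h z
    proof -
      define m where "m = (z, \<beta> * snd (last h))"
      have lm: "legal_move H h m" using delete[OF h] by (simp add: m_def)
      then have "legal_history H (h @ [m])" using h(1) by (simp add: legal_history_snoc)
      then obtain p where p: "legal_play H p" "prefix_of p (length (h @ [m])) = h @ [m]"
        using restricted_extend[OF ws, of R "h @ [m]"] mv unfolding H_def by metis
      have ph: "prefix_of p (length h) = h" "p (length h) = m"
        using p(2) by (auto simp: prefix_of_Suc)
      obtain k where k: "length h = Suc (2 * k)"
        using h(2) by (auto simp: to_move_def elim!: oddE split: if_splits)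
      have "0 < snd m" using lm by (auto simp: H_def absolute_game_def formal_balls_def)
      then have "z \<in> ball_of (p (Suc (2 * k)))"
        using ph(2) k by (simp add: m_def ball_of_def)
      then have "z \<notin> ball_of (p (2 * Suc k))"
        using absolute_play(3)[OF H_play[OF p(1)], of k] by blast
      then have "z \<notin> outcome p" unfolding outcome_def by blast
      then show ?thesis using p(1) ph(1) by blast
    qed
  qed
qed

text \<open>Bob, always shrinking by exactly \<open>\<beta>\<close>, can leave \<open>z\<close> after finitely many moves. A ball that
  Alice may delete lies in the ball of radius \<open>\<beta> * snd \<omega>\<close> around its centre \<open>a\<close>.\<close>

inductive evades :: "real \<Rightarrow> 'a::metric_space \<Rightarrow> 'a fball \<Rightarrow> bool" for \<beta> z where
  outside: "z \<notin> ball_of \<omega> \<Longrightarrow> evades \<beta> z \<omega>"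
| step: "(\<And>a. \<exists>y. dist (fst \<omega>) y \<le> (1 - \<beta>) * snd \<omega> \<and> 2 * \<beta> * snd \<omega> < dist y a \<and>
    evades \<beta> z (y, \<beta> * snd \<omega>)) \<Longrightarrow> evades \<beta> z \<omega>"

section \<open>Absolute game: excluding a winning strategy for Alice\<close>

lemma absolute_game_alice_cannot_win:
  fixes S :: "'a::complete_space set"
  assumes \<beta>: "0 < \<beta>" "\<beta> < 1" and S: "bernstein S"
    and evade: "\<And>(x::'a) \<rho> z. 0 < \<rho> \<Longrightarrow> \<rho> \<le> 1 \<Longrightarrow> evades \<beta> z (x, \<rho>)"
  shows "\<not> winning_strategy (absolute_game \<beta> S) Alice \<sigma>"
proof
  let ?G = "absolute_game \<beta> S"
  assume ws: "winning_strategy ?G Alice \<sigma>"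
  \<comment> \<open>Starting at radius 1 and contracting by exactly \<open>\<beta>\<close> makes
    every play shrink and keeps all radii in the range where \<open>evade\<close> applies.\<close>
  define R where "R = (\<lambda>(h :: 'a fball list) (m :: 'a fball).
    snd m = (if h = [] then 1 else \<beta> * snd (last (butlast h))))"
  define H where "H = restricted ?G Alice \<sigma> R"
  have H_play: "legal_play ?G p" if "legal_play H p" for p
    using that by (simp add: H_def legal_play_iff)
  have radius: "0 < snd (last h) \<and> snd (last h) \<le> 1"
    if "legal_history H h" "to_move h = Alice" for h
    using that
  proof (induction "length h" arbitrary: h rule: less_induct)
    case less
    then obtain g \<omega> where h: "h = g @ [\<omega>]" by (cases h rule: rev_cases) (auto simp: to_move_def)
    have bob: "to_move g = Bob"
      using less.prems(2) by (cases "to_move g") (auto simp: h to_move_snoc)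
    have lg: "legal_history H g" "legal_move H g \<omega>"
      using less.prems(1) by (auto simp: h legal_history_snoc)
    have \<omega>: "0 < snd \<omega>" "snd \<omega> = (if g = [] then 1 else \<beta> * snd (last (butlast g)))"
      using lg(2) bob by (auto simp: H_def R_def absolute_game_def formal_balls_def)
    show ?case
    proof (cases "g = []")
      case True
      then show ?thesis using \<omega> by (simp add: h)
    next
      case False
      then obtain f a where g: "g = f @ [a]" by (cases g rule: rev_cases) auto
      have "to_move f = Alice" using bob by (cases "to_move f") (auto simp: g to_move_snoc)
      moreover have "legal_history H f" using lg(1) by (simp add: g legal_history_snoc)
      ultimately have "snd (last f) \<le> 1" using less.hyps[of f] by (simp add: h g)
      then have "\<beta> * snd (last f) \<le> \<beta> * 1" using \<beta> by (intro mult_left_mono) auto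
      then have "\<beta> * snd (last f) \<le> 1" using \<beta> by linarith
      then show ?thesis using \<omega> by (simp add: h g)
    qed
  qed
  have bob_move: "legal_move H (h @ [a]) (y, \<beta> * snd (last h))"
    if h: "legal_history H h" "to_move h = Alice" "legal_move H h a"
      and y: "dist (fst (last h)) y \<le> (1 - \<beta>) * snd (last h)"
        "2 * \<beta> * snd (last h) < dist y (fst a)" for h a y
  proof -
    have "h \<noteq> []" using h(2) by (auto simp: to_move_def)
    then have a: "snd a \<le> \<beta> * snd (last h)" using h(2,3) by (auto simp: H_def absolute_game_def)
    have "ball_of (y, \<beta> * snd (last h)) \<inter> ball_of a = {}"
    proof (rule ccontr)
      assume "ball_of (y, \<beta> * snd (last h)) \<inter> ball_of a \<noteq> {}"
      then obtain w where "dist y w \<le> \<beta> * snd (last h)" "dist (fst a) w \<le> snd a"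
        by (auto simp: ball_of_def)
      then show False
        using a y(2) dist_triangle2[of y "fst a" w] by linarith
    qed
    then show ?thesis
      using h radius[OF h(1,2)] y(1) \<open>h \<noteq> []\<close> \<beta>
      by (simp add: H_def R_def absolute_game_def formal_balls_def fball_le_def to_move_snoc
          algebra_simps)
  qed
  have alice_move: "legal_move H h (\<sigma> h)" if "legal_history H h" "to_move h = Alice" for h
    using restricted_owner_move[OF ws that(1)[unfolded H_def] that(2)] by (simp add: H_def)
  have mv: "\<exists>m. legal_move ?G h m \<and> R h m"
    if h: "legal_history H h" "to_move h \<noteq> Alice" for h
  proof (cases "h = []")
    case True
    then have "legal_move ?G h (undefined, 1) \<and> R h (undefined, 1)"
      by (simp add: R_def absolute_game_def formal_balls_def)
    then show ?thesis by blast
  next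
    case False
    then obtain g a where g: "h = g @ [a]" by (cases h rule: rev_cases) auto
    have tm: "to_move g = Alice" using h(2) by (auto simp: g to_move_snoc split: if_splits)
    have lg: "legal_history H g" "legal_move H g a" using h(1) by (auto simp: g legal_history_snoc)
    have r: "0 < snd (last g)" "snd (last g) \<le> 1" using radius[OF lg(1) tm] by auto
    \<comment> \<open>Taking Bob's own centre as the point to evade shows that he is never stuck:
      the centre is not outside the ball, so evasion must come from \<open>step\<close>, which
      offers a legal move against every deleted ball.\<close>
    have "evades \<beta> (fst (last g)) (fst (last g), snd (last g))" using evade[OF r] .
    then obtain y where "dist (fst (last g)) y \<le> (1 - \<beta>) * snd (last g)"
      "2 * \<beta> * snd (last g) < dist y (fst a)"
    proof cases
      case outside
      then show ?thesis using r(1) by (simp add: ball_of_def)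
    next
      case step
      then show ?thesis using that by auto
    qed
    then have "legal_move H h (y, \<beta> * snd (last g))"
      using bob_move[OF lg(1) tm lg(2)] by (simp add: g)
    then have "legal_move ?G h (y, \<beta> * snd (last g)) \<and> R h (y, \<beta> * snd (last g))"
      using h(2) by (simp add: H_def)
    then show ?thesis by blast
  qed
  \<comment> \<open>The well-founded tree behind \<open>evades\<close> is descended with the centre
    of \<open>\<sigma> h\<close> as the deleted centre at each node, until \<open>z\<close> has been
    left.\<close>
  have leave: "\<exists>p. legal_play H p \<and> prefix_of p (length h) = h \<and> z \<notin> outcome p"
    if "evades \<beta> z \<omega>" "legal_history H h" "to_move h = Alice" "last h = \<omega>" for z \<omega> h
    using that
  proof (induction arbitrary: h rule: evades.induct)
    case (outside \<omega>)
    obtain p where p: "legal_play H p" "prefix_of p (length h) = h"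
      using restricted_extend[OF ws, of R h] mv outside.prems(1) unfolding H_def by metis
    obtain k where k: "length h = Suc (2 * k)"
      using outside.prems(2) by (auto simp: to_move_def elim!: oddE split: if_splits)
    have "last h = p (2 * k)" using p(2) k by (metis last_snoc prefix_of_Suc)
    then have "z \<notin> ball_of (p (2 * k))" using outside by simp
    then have "z \<notin> outcome p" unfolding outcome_def by blast
    then show ?case using p by blast
  next
    case (step \<omega>)
    let ?a = "\<sigma> h"
    obtain y where y: "dist (fst \<omega>) y \<le> (1 - \<beta>) * snd \<omega>" "2 * \<beta> * snd \<omega> < dist y (fst ?a)"
      and IH: "\<And>g. legal_history H g \<Longrightarrow> to_move g = Alice \<Longrightarrow> last g = (y, \<beta> * snd \<omega>) \<Longrightarrow>
        \<exists>p. legal_play H p \<and> prefix_of p (length g) = g \<and> z \<notin> outcome p"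
      using step.IH[of "fst ?a"] by blast
    define g where "g = (h @ [?a]) @ [(y, \<beta> * snd \<omega>)]"
    have am: "legal_move H h ?a" using alice_move step.prems by blast
    have "legal_move H (h @ [?a]) (y, \<beta> * snd \<omega>)"
      using bob_move[OF step.prems(1,2) am] y step.prems(3) by simp
    then have "legal_history H g" using step.prems(1) am by (simp add: g_def legal_history_snoc del: append_assoc)
    moreover have "to_move g = Alice" using step.prems(2) by (simp add: g_def to_move_def split: if_splits)
    moreover have "last g = (y, \<beta> * snd \<omega>)" by (simp add: g_def)
    ultimately obtain p where p: "legal_play H p" "prefix_of p (length g) = g" "z \<notin> outcome p"
      using IH by blast
    have "take (length h) (prefix_of p (length g)) = take (length h) g" using p(2) by simp
    then have "prefix_of p (length h) = h" by (simp add: take_prefix_of g_def)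
    then show ?case using p by blast
  qed
  show False
  proof (rule bernstein_no_winning_strategy[where G = ?G and P = Alice and \<sigma> = \<sigma> and R = R,
        folded H_def])
    show "bernstein S" "winning_strategy ?G Alice \<sigma>" by (rule S, rule ws)
    show "alice_wins ?G p \<longleftrightarrow> x \<in> S" if "outcome p = {x}" for p x
      using that by (simp add: absolute_game_def)
    show "\<exists>m. legal_move ?G h m \<and> R h m" if "legal_history H h" "to_move h \<noteq> Alice" for h
      using mv[OF that] .
    show "shrinking p" if p: "legal_play H p" for p
    proof -
      have lm: "legal_move H (prefix_of p n) (p n)" for n using p unfolding legal_play_iff by blast
      have "snd (p (2 * n)) = \<beta> ^ n" for n
      proof (induction n)
        case 0
        show ?case using lm[of 0] by (simp add: H_def R_def to_move_def)
      next
        case (Suc n)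
        then show ?case
          using lm[of "Suc (Suc (2 * n))"]
          by (simp add: H_def R_def to_move_def prefix_of_Suc butlast_append)
      qed
      then have "(\<lambda>n. snd (p (2 * n))) \<longlonglongrightarrow> 0" using \<beta> by (simp add: LIMSEQ_realpow_zero)
      then show ?thesis using absolute_play(2)[OF H_play[OF p]] by (simp add: shrinking_def)
    qed
    show "\<exists>p. legal_play H p \<and> prefix_of p (length h) = h \<and> z \<notin> outcome p"
      if h: "legal_history H h" "to_move h = Alice" for h z
    proof -
      have "evades \<beta> z (fst (last h), snd (last h))" using radius[OF h] by (intro evade) auto
      then show ?thesis using leave[OF _ h] by simp
    qed
  qed
qed

section \<open>Absolute game: undeterminedness, and evasion in both kinds of spaces\<close>

lemma absolute_game_undetermined:
  fixes S :: "'a::complete_space set"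
  assumes "0 < c" "uniformly_perfect c (UNIV :: 'a set)" "0 < \<beta>" "\<beta> < 1" "bernstein S"
    and "\<And>(x::'a) \<rho> z. 0 < \<rho> \<Longrightarrow> \<rho> \<le> 1 \<Longrightarrow> evades \<beta> z (x, \<rho>)"
  shows "undetermined (absolute_game \<beta> S)"
proof -
  have lim: "y islimpt UNIV" for y :: 'a
    unfolding islimpt_approachable
  proof (intro allI impI)
    fix e :: real assume "e > 0"
    then have r: "0 < min 1 (e / 2)" "min 1 (e / 2) \<le> 1" by auto
    obtain w where w: "dist y w \<le> min 1 (e / 2)" "c * min 1 (e / 2) < dist y w"
      using uniformly_perfectE[OF assms(2) r] .
    have "0 < c * min 1 (e / 2)" using \<open>0 < c\<close> r by simp
    then have "w \<noteq> y" "dist w y < e" using w \<open>e > 0\<close> by (auto simp: dist_commute)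
    then show "\<exists>x'\<in>UNIV. x' \<noteq> y \<and> dist x' y < e" by blast
  qed
  have "\<not> winning_strategy (absolute_game \<beta> S) P \<sigma>" for P \<sigma>
    using absolute_game_alice_cannot_win[OF assms(3-6)]
      absolute_game_bob_cannot_win[OF assms(3,5) lim] by (cases P) auto
  then show ?thesis by (simp add: determined_def)
qed

text \<open>Three points of pairwise distance above \<open>4 * \<beta> * \<rho>\<close>: Alice's ball rules out at most one of
  them, and \<open>z\<close> another one.\<close>

lemma uniformly_perfect_evades:
  fixes x z :: "'a::metric_space"
  assumes up: "uniformly_perfect c (UNIV :: 'a set)" and "0 < c"
    and \<beta>: "0 < \<beta>" "\<beta> < (c / 5)\<^sup>2" and \<rho>: "0 < \<rho>" "\<rho> \<le> 1"
  shows "evades \<beta> z (x, \<rho>)"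
proof -
  obtain w where "dist x w \<le> 1" "c * 1 < dist x w"
    using uniformly_perfectE[OF up, of 1 x] by auto
  then have "c < 1" by linarith
  have c2: "c\<^sup>2 < c" using \<open>0 < c\<close> \<open>c < 1\<close> by (simp add: power2_eq_square)
  have \<beta>25: "25 * \<beta> < c\<^sup>2" using \<beta>(2) by (simp add: power_divide)
  have \<beta>c: "\<beta> < 1" "4 * \<beta> < c" using \<beta>25 c2 \<open>c < 1\<close> \<beta>(1) by linarith+
  define r1 where "r1 = (1 - \<beta>) * \<rho>"
  \<comment> \<open>Chosen so that \<open>c * r2 = 4 * \<beta> * \<rho>\<close>: a point from the
    shell of radius \<open>r2\<close> is just far enough from \<open>x\<close>. By
    \<open>sep\<close>, a point from the shell of radius \<open>r1\<close> is then far from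
    both.\<close>
  define r2 where "r2 = 4 * \<beta> * \<rho> / c"
  have r1: "0 < r1" "r1 \<le> 1" using \<beta> \<beta>c \<rho> by (auto simp: r1_def intro: mult_le_one)
  have r2: "0 < r2" using \<beta> \<rho> \<open>0 < c\<close> by (simp add: r2_def)
  have cr2: "c * r2 = 4 * \<beta> * \<rho>" using \<open>0 < c\<close> by (simp add: r2_def)
  have sep: "4 * \<beta> * \<rho> + r2 < c * r1"
  proof -
    \<comment> \<open>After multiplication by \<open>c / \<rho>\<close> the claim reads
      \<open>4 * \<beta> * c + 4 * \<beta> < c\<^sup>2 * (1 - \<beta>)\<close>. As
      \<open>25 * \<beta> < c\<^sup>2 < 1\<close>, the left side is below \<open>8 * \<beta>\<close>
      and the right side above \<open>24 * \<beta>\<close>.\<close>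
    have "c\<^sup>2 * (24 / 25) \<le> c\<^sup>2 * (1 - \<beta>)"
      using \<beta>25 c2 \<open>c < 1\<close> by (intro mult_left_mono) auto
    moreover have "\<beta> * c \<le> \<beta> * 1" using \<beta> \<open>c < 1\<close> by (intro mult_left_mono) auto
    ultimately have "4 * (\<beta> * c) + 4 * \<beta> < c\<^sup>2 * (1 - \<beta>)" using \<beta>25 \<beta>(1) by linarith
    then have "(4 * (\<beta> * c) + 4 * \<beta>) * \<rho> < c\<^sup>2 * (1 - \<beta>) * \<rho>"
      using \<rho>(1) by (rule mult_strict_right_mono)
    then have "c * (4 * \<beta> * \<rho> + r2) < c * (c * r1)"
      using cr2 by (simp add: r1_def power2_eq_square algebra_simps)
    then show ?thesis using \<open>0 < c\<close> by simp
  qed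
  have "c * r1 \<le> r1" using \<open>c < 1\<close> r1 by simp
  moreover have "0 < 4 * \<beta> * \<rho>" using \<beta>(1) \<rho>(1) by simp
  ultimately have r21: "r2 \<le> r1" using sep by linarith
  obtain y1 where y1: "dist x y1 \<le> r1" "c * r1 < dist x y1"
    using uniformly_perfectE[OF up r1] .
  have "r2 \<le> 1" using r21 r1(2) by linarith
  then obtain y2 where y2: "dist x y2 \<le> r2" "c * r2 < dist x y2"
    using uniformly_perfectE[OF up r2] by blast
  have "\<exists>y. dist x y \<le> r1 \<and> 2 * \<beta> * \<rho> < dist y a \<and> \<beta> * \<rho> < dist y z" for a
  proof -
    have far: "4 * \<beta> * \<rho> < dist x y1" "4 * \<beta> * \<rho> < dist x y2" "4 * \<beta> * \<rho> < dist y1 y2"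
      using y1 y2 cr2 sep r2 dist_triangle[of x y1 y2] by (simp_all add: dist_commute)
    have le: "dist x x \<le> r1" "dist x y1 \<le> r1" "dist x y2 \<le> r1" using r1 y1 y2 r21 by auto
    \<comment> \<open>Pigeonhole: each of \<open>a\<close> and \<open>z\<close> is within
      \<open>2 * \<beta> * \<rho>\<close> of at most one of the three points.\<close>
    have "\<exists>y\<in>{x, y1, y2}. 2 * \<beta> * \<rho> < dist y a \<and> \<beta> * \<rho> < dist y z"
    proof (rule ccontr)
      assume "\<not> ?thesis"
      moreover have "\<beta> * \<rho> \<le> 2 * \<beta> * \<rho>" using \<beta>(1) \<rho>(1) by simp
      ultimately have "dist x a \<le> 2 * \<beta> * \<rho> \<or> dist x z \<le> 2 * \<beta> * \<rho>"
        "dist y1 a \<le> 2 * \<beta> * \<rho> \<or> dist y1 z \<le> 2 * \<beta> * \<rho>"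
        "dist y2 a \<le> 2 * \<beta> * \<rho> \<or> dist y2 z \<le> 2 * \<beta> * \<rho>"
        by auto
      then show False
        using far dist_triangle2[of x y1 a] dist_triangle2[of x y2 a] dist_triangle2[of y1 y2 a]
          dist_triangle2[of x y1 z] dist_triangle2[of x y2 z] dist_triangle2[of y1 y2 z]
        by linarith
    qed
    then obtain y where y: "y \<in> {x, y1, y2}" "2 * \<beta> * \<rho> < dist y a" "\<beta> * \<rho> < dist y z"
      by blast
    moreover have "dist x y \<le> r1" using y(1) le by auto
    ultimately show ?thesis by blast
  qed
  note dodge = this
  show ?thesis
  proof (rule evades.step)
    fix a
    obtain y where y: "dist x y \<le> r1" "2 * \<beta> * \<rho> < dist y a" "\<beta> * \<rho> < dist y z"
      using dodge by blast
    then have "evades \<beta> z (y, \<beta> * \<rho>)" by (intro evades.outside) (simp add: ball_of_def)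
    then show "\<exists>y. dist (fst (x, \<rho>)) y \<le> (1 - \<beta>) * snd (x, \<rho>) \<and>
        2 * \<beta> * snd (x, \<rho>) < dist y a \<and> evades \<beta> z (y, \<beta> * snd (x, \<rho>))"
      using y by (intro exI[of _ y]) (simp add: r1_def)
  qed
qed

text \<open>Closure under the expanding maps makes an interval in \<open>D\<close> grow by the factor \<open>3 / 2\<close>,
  folding at the origin included.\<close>

lemma expanding_invariant_set_empty:
  fixes D :: "real set"
  assumes \<beta>: "0 < \<beta>" "\<beta> < 1 / 3" and D: "D \<subseteq> {0..1}"
    and inv: "\<And>t s. t \<in> D \<Longrightarrow> 5 * \<beta> - 1 < s \<Longrightarrow> s \<le> 1 - \<beta> \<Longrightarrow> \<bar>t - s\<bar> / \<beta> \<in> D"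
  shows "D = {}"
proof (rule ccontr)
  assume "D \<noteq> {}"
  then obtain t where t: "t \<in> D" by blast
  \<comment> \<open>The absolute value is injective on the half of an interval beyond its midpoint,
    seen from the origin, so folding costs at most a factor 2.\<close>
  have fold: "\<exists>a. {a..a + w / 2} \<subseteq> D" if w: "0 \<le> w" "\<And>v. u \<le> v \<Longrightarrow> v \<le> u + w \<Longrightarrow> \<bar>v\<bar> \<in> D" for u w
  proof (cases "0 \<le> u + w / 2")
    case True
    have "{u + w / 2..u + w / 2 + w / 2} \<subseteq> D"
    proof
      fix v assume "v \<in> {u + w / 2..u + w / 2 + w / 2}"
      then show "v \<in> D" using w(2)[of v] w(1) True by simp
    qed
    then show ?thesis by blast
  next
    case False
    have "{- (u + w / 2)..- (u + w / 2) + w / 2} \<subseteq> D"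
    proof
      fix v assume "v \<in> {- (u + w / 2)..- (u + w / 2) + w / 2}"
      then show "v \<in> D" using w(2)[of "- v"] w(1) False by simp
    qed
    then show ?thesis by blast
  qed
  \<comment> \<open>From a single \<open>t\<close>, let \<open>s\<close> run through
    \<open>[2 * \<beta>, 1 - \<beta>]\<close>, which is admissible since
    \<open>5 * \<beta> - 1 < 2 * \<beta>\<close>. Its length \<open>1 - 3 * \<beta>\<close> is
    divided by \<open>\<beta>\<close> and then halved by folding.\<close>
  define len where "len = (1 - 3 * \<beta>) / \<beta> / 2"
  have len: "0 < len" using \<beta> by (simp add: len_def)
  have grow: "\<exists>a. {a..a + len * (3 / 2) ^ n} \<subseteq> D" for n
  proof (induction n)
    case 0
    have "\<exists>a. {a..a + (1 - 3 * \<beta>) / \<beta> / 2} \<subseteq> D"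
    proof (rule fold[of _ "(t - (1 - \<beta>)) / \<beta>"])
      show "0 \<le> (1 - 3 * \<beta>) / \<beta>" using \<beta> by simp
      fix v assume v: "(t - (1 - \<beta>)) / \<beta> \<le> v" "v \<le> (t - (1 - \<beta>)) / \<beta> + (1 - 3 * \<beta>) / \<beta>"
      have "t - (1 - \<beta>) \<le> v * \<beta>" using v(1) \<beta> by (simp add: pos_divide_le_eq)
      moreover have "v \<le> (t - 2 * \<beta>) / \<beta>" using v(2) by (simp add: add_divide_distrib[symmetric])
      then have "v * \<beta> \<le> t - 2 * \<beta>" using \<beta> by (simp add: pos_le_divide_eq)
      ultimately have "\<bar>t - (t - v * \<beta>)\<bar> / \<beta> \<in> D" using \<beta> by (intro inv t) auto
      then show "\<bar>v\<bar> \<in> D" using \<beta> by (simp add: abs_mult)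
    qed
    then show ?case by (simp add: len_def)
  next
    case (Suc n)
    then obtain a where a: "{a..a + len * (3 / 2) ^ n} \<subseteq> D" by blast
    let ?L = "len * (3 / 2) ^ n"
    have L: "0 < ?L" using len by simp
    \<comment> \<open>The single map with \<open>s = 1 - \<beta>\<close> suffices for growth: it
      stretches by \<open>1 / \<beta> > 3\<close>, of which folding leaves more than
      \<open>3 / 2\<close>.\<close>
    have "\<exists>b. {b..b + ?L / \<beta> / 2} \<subseteq> D"
    proof (rule fold[of _ "(a - (1 - \<beta>)) / \<beta>"])
      show "0 \<le> ?L / \<beta>" using \<beta> L by simp
      fix v assume v: "(a - (1 - \<beta>)) / \<beta> \<le> v" "v \<le> (a - (1 - \<beta>)) / \<beta> + ?L / \<beta>"
      have "a - (1 - \<beta>) \<le> v * \<beta>" using v(1) \<beta> by (simp add: pos_divide_le_eq)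
      moreover have "v \<le> (a - (1 - \<beta>) + ?L) / \<beta>" using v(2) by (simp only: add_divide_distrib)
      then have "v * \<beta> \<le> a - (1 - \<beta>) + ?L" using \<beta> by (simp add: pos_le_divide_eq)
      ultimately have "v * \<beta> + (1 - \<beta>) \<in> {a..a + ?L}" by simp
      then have "v * \<beta> + (1 - \<beta>) \<in> D" using a by blast
      then have "\<bar>v * \<beta> + (1 - \<beta>) - (1 - \<beta>)\<bar> / \<beta> \<in> D" using \<beta> by (intro inv) auto
      then show "\<bar>v\<bar> \<in> D" using \<beta> by (simp add: abs_mult)
    qed
    then obtain b where b: "{b..b + ?L / \<beta> / 2} \<subseteq> D" by blast
    have "3 * \<beta> * ?L \<le> 1 * ?L" using \<beta> L by (intro mult_right_mono) auto
    then have "3 * ?L \<le> ?L / \<beta>" using \<beta> by (simp add: pos_le_divide_eq mult_ac)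
    then have "len * (3 / 2) ^ Suc n \<le> ?L / \<beta> / 2" by simp
    then have "{b..b + len * (3 / 2) ^ Suc n} \<subseteq> D" using b by (force simp del: power_Suc)
    then show ?case by blast
  qed
  obtain n where n: "1 / len < (3 / 2) ^ n" using real_arch_pow[of "3 / 2" "1 / len"] by auto
  obtain a where a: "{a..a + len * (3 / 2) ^ n} \<subseteq> D" using grow by blast
  have L: "1 < len * (3 / 2) ^ n" using n len by (simp add: pos_divide_less_eq mult.commute)
  then have "a \<in> D" "a + len * (3 / 2) ^ n \<in> D" using a by auto
  then have "0 \<le> a" "a + len * (3 / 2) ^ n \<le> 1" using D by (auto simp: subset_iff)
  then show False using L by linarith
qed

text \<open>On the line through \<open>x\<close> and \<open>z\<close>, the point farthest from \<open>z\<close> leaves \<open>z\<close> at once. If Alice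
  prevents that move, then she has no influence on the points beyond \<open>(5 * \<beta> - 1) * \<rho>\<close> on the
  side of \<open>z\<close>.\<close>

lemma banach_evades:
  fixes x z :: "'a::banach"
  assumes ne: "\<exists>e::'a. e \<noteq> 0" and \<beta>: "0 < \<beta>" "\<beta> < 1 / 3" and "0 < \<rho>"
  shows "evades \<beta> z (x, \<rho>)"
proof -
  define D where "D = {t. \<exists>x \<rho>. 0 < \<rho> \<and> \<not> evades \<beta> z (x, \<rho>) \<and> dist x z = t * \<rho>}"
  have "D = {}"
  proof (rule expanding_invariant_set_empty[OF \<beta>])
    show "D \<subseteq> {0..1}"
    proof
      fix t assume "t \<in> D"
      then obtain x \<rho> where t: "0 < \<rho>" "\<not> evades \<beta> z (x, \<rho>)" "dist x z = t * \<rho>"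
        by (auto simp: D_def)
      have "t * \<rho> \<le> 1 * \<rho>" using t(2,3) evades.outside[of z "(x, \<rho>)" \<beta>] by (auto simp: ball_of_def)
      moreover have "0 * \<rho> \<le> t * \<rho>" using t(3) zero_le_dist[of x z] by simp
      ultimately show "t \<in> {0..1}" using t(1) by (simp only: mult_le_cancel_right) auto
    qed
    fix t s assume "t \<in> D" and s: "5 * \<beta> - 1 < s" "s \<le> 1 - \<beta>"
    then obtain x \<rho> where \<rho>: "0 < \<rho>" and nev: "\<not> evades \<beta> z (x, \<rho>)" and t: "dist x z = t * \<rho>"
      by (auto simp: D_def)
    have "0 \<le> t * \<rho>" using t zero_le_dist[of x z] by simp
    \<comment> \<open>Failure of \<open>step\<close> provides one answer of Alice that is good
      against all of Bob's moves at once.\<close>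
    obtain a where a: "\<And>y. dist x y \<le> (1 - \<beta>) * \<rho> \<Longrightarrow> 2 * \<beta> * \<rho> < dist y a \<Longrightarrow>
        \<not> evades \<beta> z (y, \<beta> * \<rho>)"
      using evades.step[of "(x, \<rho>)" \<beta> z] nev by auto
    obtain v where v: "norm v = 1" "z = x + (t * \<rho>) *\<^sub>R v"
      using direction_to[OF ne, of z x] t by metis
    define y where "y = (\<lambda>s. x + (s * \<rho>) *\<^sub>R v)"
    have dist_y: "dist (y s) (y s') = \<bar>s - s'\<bar> * \<rho>" for s s'
    proof -
      have "y s - y s' = ((s - s') * \<rho>) *\<^sub>R v" by (simp add: y_def algebra_simps)
      then show ?thesis using v(1) \<rho> by (simp add: dist_norm abs_mult)
    qed
    have yx: "x = y 0" and yz: "z = y t" using v(2) by (auto simp: y_def)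
    have "0 \<le> t" using \<open>0 \<le> t * \<rho>\<close> \<rho> by (simp add: zero_le_mult_iff)
    have "\<beta> * \<rho> < dist (y (- (1 - \<beta>))) z"
    proof -
      have "\<beta> < \<bar>- (1 - \<beta>) - t\<bar>" using \<beta> \<open>0 \<le> t\<close> by linarith
      then show ?thesis using \<rho> unfolding yz dist_y by simp
    qed
    then have "evades \<beta> z (y (- (1 - \<beta>)), \<beta> * \<rho>)"
      by (intro evades.outside) (simp add: ball_of_def)
    moreover have "dist x (y (- (1 - \<beta>))) \<le> (1 - \<beta>) * \<rho>"
      unfolding yx dist_y using \<beta> by simp
    ultimately have "dist (y (- (1 - \<beta>))) a \<le> 2 * \<beta> * \<rho>" using a by force
    \<comment> \<open>Alice's centre is within \<open>2 * \<beta> * \<rho>\<close> of the extreme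
      point \<open>- (1 - \<beta>)\<close>, so a point more than \<open>4 * \<beta> * \<rho>\<close>
      from it is safe; \<open>- (1 - \<beta>) + 4 * \<beta>\<close> is the threshold
      \<open>5 * \<beta> - 1\<close>.\<close>
    moreover have "4 * \<beta> * \<rho> < dist (y s) (y (- (1 - \<beta>)))"
    proof -
      have "4 * \<beta> < \<bar>s - (- (1 - \<beta>))\<bar>" using s \<beta> by linarith
      then show ?thesis using \<rho> unfolding dist_y by simp
    qed
    ultimately have "2 * \<beta> * \<rho> < dist (y s) a"
      using dist_triangle2[of "y s" "y (- (1 - \<beta>))" a] by linarith
    moreover have "dist x (y s) \<le> (1 - \<beta>) * \<rho>"
    proof -
      have "\<bar>0 - s\<bar> \<le> 1 - \<beta>" using s \<beta> by linarith
      then show ?thesis unfolding yx dist_y using \<rho> by simp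
    qed
    ultimately have "\<not> evades \<beta> z (y s, \<beta> * \<rho>)" using a by blast
    \<comment> \<open>The division by \<open>\<beta>\<close>, and with it the expansion, comes from
      measuring in units of the new radius \<open>\<beta> * \<rho>\<close>.\<close>
    moreover have "dist (y s) z = \<bar>t - s\<bar> / \<beta> * (\<beta> * \<rho>)"
      unfolding yz dist_y using \<beta> by (simp add: abs_minus_commute)
    ultimately show "\<bar>t - s\<bar> / \<beta> \<in> D" using \<beta> \<rho> unfolding D_def mem_Collect_eq
      by (intro exI[of _ "y s"] exI[of _ "\<beta> * \<rho>"]) simp
  qed
  moreover have "dist x z / \<rho> \<in> D" if "\<not> evades \<beta> z (x, \<rho>)"
    using that \<open>0 < \<rho>\<close> unfolding D_def by force
  ultimately show ?thesis by blast
qed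

theorem theorem1p7:
  fixes c \<alpha> \<beta> :: real
  assumes "c > 0" and "0 < \<alpha>" and "\<alpha> < 1" and "0 < \<beta>" and "\<beta> < 1"
  shows
    "(\<forall>S :: 'a::complete_space set.
        uniformly_perfect c (UNIV :: 'a set) \<and> bernstein S \<longrightarrow>
          (\<alpha> < c / (1 + 2 * c) \<and> \<beta> < c / (1 + 2 * c) \<longrightarrow>
             undetermined (schmidt_game \<alpha> \<beta> S) \<and> undetermined (strong_game \<alpha> \<beta> S)) \<and>
          (\<beta> < (c / 5)\<^sup>2 \<longrightarrow> undetermined (absolute_game \<beta> S)))
   \<and> (\<forall>S :: 'b::banach set.
        uniformly_perfect c (UNIV :: 'b set) \<and> bernstein S \<longrightarrow>
          (1 + \<alpha> * \<beta> > 2 * max \<alpha> \<beta> \<longrightarrow>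
             undetermined (schmidt_game \<alpha> \<beta> S) \<and> undetermined (strong_game \<alpha> \<beta> S)) \<and>
          (\<beta> < 1 / 3 \<longrightarrow> undetermined (absolute_game \<beta> S)))"
proof (intro conjI allI impI; elim conjE)
  fix S :: "'a set"
  assume up: "uniformly_perfect c (UNIV :: 'a set)" and S: "bernstein S"
  {
    assume *: "\<alpha> < c / (1 + 2 * c)" "\<beta> < c / (1 + 2 * c)"
    show "undetermined (schmidt_game \<alpha> \<beta> S)" "undetermined (strong_game \<alpha> \<beta> S)"
      by (rule ratio_games_undetermined[OF assms(2-5) S], rule uniformly_perfect_evade[OF up \<open>c > 0\<close>];
          use * assms in auto)+
  }
  assume "\<beta> < (c / 5)\<^sup>2"
  then show "undetermined (absolute_game \<beta> S)"
    using absolute_game_undetermined[OF \<open>c > 0\<close> up assms(4,5) S]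
      uniformly_perfect_evades[OF up \<open>c > 0\<close> assms(4)] by blast
next
  fix S :: "'b set"
  assume up: "uniformly_perfect c (UNIV :: 'b set)" and S: "bernstein S"
  \<comment> \<open>Uniform perfectness with \<open>c > 0\<close> excludes the zero space, in which
    there is no direction to move in.\<close>
  obtain y :: 'b where "c * 1 < dist 0 y" using uniformly_perfectE[OF up, of 1 0] by auto
  then have "y \<noteq> 0" using \<open>c > 0\<close> by auto
  then have ne: "\<exists>e::'b. e \<noteq> 0" by blast
  {
    assume "1 + \<alpha> * \<beta> > 2 * max \<alpha> \<beta>"
    then have *: "2 * \<alpha> < 1 + \<alpha> * \<beta>" "2 * \<beta> < 1 + \<alpha> * \<beta>" by auto
    show "undetermined (schmidt_game \<alpha> \<beta> S)" "undetermined (strong_game \<alpha> \<beta> S)"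
      by (rule ratio_games_undetermined[OF assms(2-5) S], rule banach_evade[OF ne];
          use * assms in \<open>auto simp: mult.commute\<close>)+
  }
  assume "\<beta> < 1 / 3"
  then show "undetermined (absolute_game \<beta> S)"
    using absolute_game_undetermined[OF \<open>c > 0\<close> up assms(4,5) S] banach_evades[OF ne assms(4)]
    by blast
qed

end
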